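(* Let $-A$ be the generator of a bounded analytic semigroup in a Hilbert space $\mathcal{H}$ and assume that the quadratic estimate $$\left(\int_0^\infty\|sA^*e^{-sA^*}h\|^2\,\frac{ds}{s}\right)^{1/2}\le C\|h\|\qquad\text{for all }h\in\mathcal{H}$$ holds for some constant $C<\infty$. Then for all $f\in L^2(0,\infty;t^{-1}dt,\mathcal{H})$ the formula $$\mathcal{M}_{-}f(t):=\widetilde{\mathcal{M}}_{-}f(t)+e^{-tA}\int_0^\infty Ae^{-sA}f(s)\,ds$$ defines $\mathcal{M}_{-}f\in L^2_{loc}(0,\infty;dt,\mathcal{H})$, with the estimate $$\sup_{\tau>0}\frac1\tau\int_\tau^{2\tau}\|\mathcal{M}_{-}f(t)\|^2\,dt\le C'\int_0^\infty\|f(s)\|^2\,\frac{ds}{s}$$ (with $C'$ independent of $f$) and the limit $$\lim_{\tau\to0}\frac1\tau\int_\tau^{2\tau}\mathcal{M}_{-}f(t)\,dt=\int_0^\infty Ae^{-sA}f(s)\,ds\quad\text{in }\mathcal{H}.$$ In particular, for $f\in L^2(0,\infty;t^{-1}dt,\mathcal{H})$, one has $\mathcal{M}_{-}f\in L^2(0,\infty;t^{-1}dt,\mathcal{H})$ if and only if $$\lim_{\tau\to0}\frac1\tau\int_\tau^{2\tau}\mathcal{M}_{-}f(t)\,dt=0.$$ The last condition defines a closed subspace of $L^2(0,\infty;t^{-1}dt,\mathcal{H})$, and there is a constant $C''$ such that for all $f$ in this subspace $$\|\mathcal{M}_{-}f\|_{L^2(0,\infty;t^{-1}dt,\mathcal{H})}\le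 C''\|f\|_{L^2(0,\infty;t^{-1}dt,\mathcal{H})}.$$
   Context: $\mathcal{H}$ is a Hilbert space with norm $\|\cdot\|$ and inner product $(\cdot,\cdot)$. "$-A$ generates a bounded analytic semigroup" means that $A$ is a densely defined closed linear operator on $\mathcal{H}$ and $-A$ generates a bounded analytic semigroup $\{e^{-zA}:|\arg z|<\delta\}$ for some $0<\delta<\pi/2$. $\mathsf{D}(A)$ is the domain of $A$ (with graph norm). $L^2(0,\infty;t^{-1}dt,\mathcal{H})$ is the space of strongly measurable $f:(0,\infty)\to\mathcal{H}$ with $\int_0^\infty\|f(t)\|^2\,\frac{dt}{t}<\infty$. The subscript $c$ means compact support in $(0,\infty)$, and $L^2_{loc}(0,\infty;dt,\mathcal{H})$ means square integrable on compact subsets of $(0,\infty)$. Definition of $\widetilde{\mathcal{M}}_{-}$: for $f\in L^2_c(0,\infty;dt,\mathsf{D}(A))$ and $t>0$ put $$\widetilde{\mathcal{M}}_{-}f(t)=\int_t^\infty Ae^{-(s-t)A}f(s)\,ds-e^{-tA}\int_0^\infty Ae^{-sA}f(s)\,ds.$$ This operator extends by density to a bounded linear operator on $L^2(0,\infty;t^{-1}dt,\mathcal{H})$, still denoted $\widetilde{\mathcal{M}}_{-}$. Meaning of $\int_0^\infty Ae^{-sA}f(s)\,ds$ for $f\in L^2(0,\infty;t^{-1}dt,\mathcal{H})$: it is the weak limit in $\mathcal{H}$ of the integrals $\int_\delta^R Ae^{-sA}f(s)\,ds$ as $\delta\to0$ and $R\to\infty$; this weak limit exists under the quadratic estimate assumed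 for $A^*$. *)

theory Defs
  imports "HOL-Analysis.Analysis"
begin

section \<open>Complex Hilbert spaces\<close>

text \<open>The inner product is linear in its first argument. Completeness comes from the class
  \<open>banach\<close>, positive definiteness from \<open>cinner_self\<close>. No separability is assumed.\<close>

class complex_hilbert = banach +
  fixes scaleC :: "complex \<Rightarrow> 'a \<Rightarrow> 'a" (infixr "*\<^sub>C" 75)
    and cinner :: "'a \<Rightarrow> 'a \<Rightarrow> complex"
  assumes scaleC_add_right: "c *\<^sub>C (x + y) = c *\<^sub>C x + c *\<^sub>C y"
    and scaleC_add_left: "(c + d) *\<^sub>C x = c *\<^sub>C x + d *\<^sub>C x"
    and scaleC_scaleC: "c *\<^sub>C (d *\<^sub>C x) = (c * d) *\<^sub>C x"
    and scaleC_of_real: "complex_of_real r *\<^sub>C x = r *\<^sub>R x"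
    and cinner_add_left: "cinner (x + y) z = cinner x z + cinner y z"
    and cinner_scaleC_left: "cinner (c *\<^sub>C x) y = c * cinner x y"
    and cinner_commute: "cinner y x = cnj (cinner x y)"
    and cinner_self: "cinner x x = complex_of_real ((norm x)\<^sup>2)"

definition bounded_clinear :: "('h::complex_hilbert \<Rightarrow> 'h) \<Rightarrow> bool" where
  "bounded_clinear U \<longleftrightarrow> bounded_linear U \<and> (\<forall>c x. U (c *\<^sub>C x) = c *\<^sub>C U x)"


section \<open>Strong measurability and the Bochner integral\<close>

text \<open>The Bochner integral of \<open>HOL-Analysis\<close> requires a second countable codomain. The following
  definitions repeat it for an arbitrary real normed space, with Borel measurability replaced by
  strong measurability (almost everywhere limit of simple functions).\<close>

definition strongly_measurable :: "'a measure \<Rightarrow> ('a \<Rightarrow> 'b::real_normed_vector) \<Rightarrow> bool" where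
  "strongly_measurable M f \<longleftrightarrow>
     (\<exists>s. (\<forall>i::nat. simple_function M (s i)) \<and> (AE x in M. (\<lambda>i. s i x) \<longlonglongrightarrow> f x))"

definition has_strong_integral ::
  "'a measure \<Rightarrow> ('a \<Rightarrow> 'b::real_normed_vector) \<Rightarrow> 'b \<Rightarrow> bool" where
  "has_strong_integral M f y \<longleftrightarrow> strongly_measurable M f \<and>
     (\<exists>s. (\<forall>i::nat. Bochner_Integration.simple_bochner_integrable M (s i)) \<and>
          (\<lambda>i. \<integral>\<^sup>+x. ennreal (norm (f x - s i x)) \<partial>M) \<longlonglongrightarrow> 0 \<and>
          (\<lambda>i. Bochner_Integration.simple_bochner_integral M (s i)) \<longlonglongrightarrow> y)"

definition strong_integral :: "real set \<Rightarrow> (real \<Rightarrow> 'b::real_normed_vector) \<Rightarrow> 'b" where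
  "strong_integral I f =
     (if \<exists>y. has_strong_integral (lebesgue_on I) f y
      then THE y. has_strong_integral (lebesgue_on I) f y else 0)"


section \<open>Unbounded operators and bounded analytic semigroups\<close>

text \<open>An operator is represented by its graph; its domain is \<open>Domain A\<close>.\<close>

definition linear_operator :: "('h::complex_hilbert \<times> 'h) set \<Rightarrow> bool" where
  "linear_operator A \<longleftrightarrow> single_valued A \<and> (0, 0) \<in> A \<and>
     (\<forall>x y x' y'. (x, y) \<in> A \<longrightarrow> (x', y') \<in> A \<longrightarrow> (x + x', y + y') \<in> A) \<and>
     (\<forall>c x y. (x, y) \<in> A \<longrightarrow> (c *\<^sub>C x, c *\<^sub>C y) \<in> A)"

definition op_app :: "('h \<times> 'h) set \<Rightarrow> 'h \<Rightarrow> 'h" where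
  "op_app A x = (THE y. (x, y) \<in> A)"

definition adj :: "('h::complex_hilbert \<times> 'h) set \<Rightarrow> ('h \<times> 'h) set" where
  "adj A = {(y, z). \<forall>(u, v)\<in>A. cinner v y = cinner u z}"

definition sector :: "real \<Rightarrow> complex set" where
  "sector \<delta> = {z. z \<noteq> 0 \<and> \<bar>Arg z\<bar> < \<delta>}"

text \<open>A semigroup on the sector of half angle \<open>\<delta>\<close>: holomorphic with respect to the operator norm,
  uniformly bounded, and strongly continuous at \<open>0\<close>. Values of \<open>S\<close> off the sector, except
  \<open>S 0\<close>, play no role.\<close>

definition bdd_analytic_semigroup ::
  "real \<Rightarrow> (complex \<Rightarrow> 'h::complex_hilbert \<Rightarrow> 'h) \<Rightarrow> bool" where
  "bdd_analytic_semigroup \<delta> S \<longleftrightarrow>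
     S 0 = id \<and>
     (\<forall>z\<in>sector \<delta>. bounded_clinear (S z)) \<and>
     (\<forall>z\<in>sector \<delta>. \<forall>w\<in>sector \<delta>. S (z + w) = S z \<circ> S w) \<and>
     (\<forall>z\<in>sector \<delta>. \<exists>D. bounded_clinear D \<and>
        ((\<lambda>w. onorm (\<lambda>x. inverse (w - z) *\<^sub>C (S w x - S z x) - D x)) \<longlongrightarrow> 0) (at z)) \<and>
     (\<exists>B. \<forall>z\<in>sector \<delta>. \<forall>x. norm (S z x) \<le> B * norm x) \<and>
     (\<forall>x. ((\<lambda>z. S z x) \<longlongrightarrow> x) (at 0 within sector \<delta>))"

text \<open>The graph of \<open>A\<close>, where \<open>-A\<close> is the generator of \<open>S\<close>.\<close>

definition neg_generator :: "(complex \<Rightarrow> 'h::complex_hilbert \<Rightarrow> 'h) \<Rightarrow> ('h \<times> 'h) set" where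
  "neg_generator S =
     {(x, y). ((\<lambda>t. (1 / t) *\<^sub>R (x - S (complex_of_real t) x)) \<longlongrightarrow> y) (at_right 0)}"

definition neg_generates_bdd_analytic :: "('h::complex_hilbert \<times> 'h) set \<Rightarrow> bool" where
  "neg_generates_bdd_analytic A \<longleftrightarrow>
     linear_operator A \<and> closed A \<and> closure (Domain A) = UNIV \<and>
     (\<exists>\<delta> S. 0 < \<delta> \<and> \<delta> < pi / 2 \<and> bdd_analytic_semigroup \<delta> S \<and> neg_generator S = A)"

text \<open>The operator \<open>exp (-t A)\<close> for \<open>t \<ge> 0\<close>; a semigroup is determined by its generator.\<close>

definition exp_neg :: "('h::complex_hilbert \<times> 'h) set \<Rightarrow> real \<Rightarrow> 'h \<Rightarrow> 'h" where
  "exp_neg A t = (THE U. \<exists>\<delta> S. 0 < \<delta> \<and> \<delta> < pi / 2 \<and>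
     bdd_analytic_semigroup \<delta> S \<and> neg_generator S = A \<and> U = S (complex_of_real t))"

definition A_exp :: "('h::complex_hilbert \<times> 'h) set \<Rightarrow> real \<Rightarrow> 'h \<Rightarrow> 'h" where
  "A_exp A t x = op_app A (exp_neg A t x)"


section \<open>Function spaces on the half line\<close>

text \<open>Elements of the function spaces are represented by functions on \<open>real\<close>, of which only the
  values on \<open>(0,\<infinity>)\<close> up to null sets matter. \<open>L2w_sq f\<close> is the square of the norm of \<open>f\<close> in
  \<open>L\<^sup>2(0,\<infinity>; dt/t, H)\<close>.\<close>

definition L2w_sq :: "(real \<Rightarrow> 'h::complex_hilbert) \<Rightarrow> ennreal" where
  "L2w_sq f = (\<integral>\<^sup>+t. ennreal ((norm (f t))\<^sup>2 / t) \<partial>lebesgue_on {0<..})"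

definition L2w :: "(real \<Rightarrow> 'h::complex_hilbert) set" where
  "L2w = {f. strongly_measurable (lebesgue_on {0<..}) f \<and> L2w_sq f < \<infinity>}"

definition L2loc :: "(real \<Rightarrow> 'h::complex_hilbert) set" where
  "L2loc = {f. strongly_measurable (lebesgue_on {0<..}) f \<and>
     (\<forall>K. compact K \<longrightarrow> K \<subseteq> {0<..} \<longrightarrow>
        (\<integral>\<^sup>+t. ennreal ((norm (f t))\<^sup>2) \<partial>lebesgue_on K) < \<infinity>)}"

text \<open>\<open>L\<^sup>2\<^sub>c(0,\<infinity>; dt, D(A))\<close>. The domain with its graph norm is identified with the graph, a subspace
  of the product space, whose norm is \<open>norm (x, y) = sqrt ((norm x)\<^sup>2 + (norm y)\<^sup>2)\<close>.\<close>

definition L2c_dom :: "('h::complex_hilbert \<times> 'h) set \<Rightarrow> (real \<Rightarrow> 'h) set" where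
  "L2c_dom A = {f.
     (AE t in lebesgue_on {0<..}. f t \<in> Domain A) \<and>
     strongly_measurable (lebesgue_on {0<..}) (\<lambda>t. (f t, op_app A (f t))) \<and>
     (\<integral>\<^sup>+t. ennreal ((norm (f t, op_app A (f t)))\<^sup>2) \<partial>lebesgue_on {0<..}) < \<infinity> \<and>
     (\<exists>K. compact K \<and> K \<subseteq> {0<..} \<and> (AE t in lebesgue_on {0<..}. t \<notin> K \<longrightarrow> f t = 0))}"

definition closed_subspace_L2w :: "(real \<Rightarrow> 'h::complex_hilbert) set \<Rightarrow> bool" where
  "closed_subspace_L2w V \<longleftrightarrow> V \<subseteq> L2w \<and> (\<lambda>t. 0) \<in> V \<and>
     (\<forall>f\<in>V. \<forall>g\<in>V. (\<lambda>t. f t + g t) \<in> V) \<and>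
     (\<forall>c. \<forall>f\<in>V. (\<lambda>t. c *\<^sub>C f t) \<in> V) \<and>
     (\<forall>F f. (\<forall>n::nat. F n \<in> V) \<longrightarrow> f \<in> L2w \<longrightarrow>
        (\<lambda>n. L2w_sq (\<lambda>t. F n t - f t)) \<longlonglongrightarrow> 0 \<longrightarrow> f \<in> V)"

definition bounded_clinear_L2w ::
  "((real \<Rightarrow> 'h::complex_hilbert) \<Rightarrow> (real \<Rightarrow> 'h)) \<Rightarrow> bool" where
  "bounded_clinear_L2w T \<longleftrightarrow>
     (\<forall>f\<in>L2w. T f \<in> L2w) \<and>
     (\<forall>f\<in>L2w. \<forall>g\<in>L2w.
        AE t in lebesgue_on {0<..}. T (\<lambda>s. f s + g s) t = T f t + T g t) \<and>
     (\<forall>c. \<forall>f\<in>L2w. AE t in lebesgue_on {0<..}. T (\<lambda>s. c *\<^sub>C f s) t = c *\<^sub>C T f t) \<and>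
     (\<exists>K::real. \<forall>f\<in>L2w. L2w_sq (T f) \<le> ennreal (K\<^sup>2) * L2w_sq f)"


section \<open>The operators\<close>

definition M_tilde_pre ::
  "('h::complex_hilbert \<times> 'h) set \<Rightarrow> (real \<Rightarrow> 'h) \<Rightarrow> real \<Rightarrow> 'h" where
  "M_tilde_pre A f t =
     strong_integral {t..} (\<lambda>s. A_exp A (s - t) (f s))
     - exp_neg A t (strong_integral {0<..} (\<lambda>s. A_exp A s (f s)))"

text \<open>\<open>T\<close> is the extension of \<open>M_tilde_pre A\<close> from \<open>L\<^sup>2\<^sub>c(0,\<infinity>; dt, D(A))\<close> to a bounded operator on
  \<open>L\<^sup>2(0,\<infinity>; dt/t, H)\<close>. By density of the former space, \<open>T f\<close> is determined up to null sets.\<close>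

definition is_M_tilde ::
  "('h::complex_hilbert \<times> 'h) set \<Rightarrow> ((real \<Rightarrow> 'h) \<Rightarrow> (real \<Rightarrow> 'h)) \<Rightarrow> bool" where
  "is_M_tilde A T \<longleftrightarrow> bounded_clinear_L2w T \<and>
     (\<forall>f\<in>L2c_dom A. AE t in lebesgue_on {0<..}. T f t = M_tilde_pre A f t)"

definition is_weak_int :: "('h::complex_hilbert \<times> 'h) set \<Rightarrow> (real \<Rightarrow> 'h) \<Rightarrow> 'h \<Rightarrow> bool" where
  "is_weak_int A f x \<longleftrightarrow>
     (\<forall>h. ((\<lambda>(\<delta>, R). cinner (strong_integral {\<delta>..R} (\<lambda>s. A_exp A s (f s))) h)
            \<longlongrightarrow> cinner x h) (at_right 0 \<times>\<^sub>F at_top))"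

definition weak_int :: "('h::complex_hilbert \<times> 'h) set \<Rightarrow> (real \<Rightarrow> 'h) \<Rightarrow> 'h" where
  "weak_int A f = (THE x. is_weak_int A f x)"

definition M_minus ::
  "('h::complex_hilbert \<times> 'h) set \<Rightarrow> ((real \<Rightarrow> 'h) \<Rightarrow> (real \<Rightarrow> 'h)) \<Rightarrow>
     (real \<Rightarrow> 'h) \<Rightarrow> real \<Rightarrow> 'h" where
  "M_minus A T f t = T f t + exp_neg A t (weak_int A f)"

definition dyadic_mean :: "(real \<Rightarrow> 'h::complex_hilbert) \<Rightarrow> real \<Rightarrow> 'h" where
  "dyadic_mean g \<tau> = (1 / \<tau>) *\<^sub>R strong_integral {\<tau>..2 * \<tau>} g"

end

theory Submission
  imports Defs
begin

text \<open>Write \<open>B f\<close> for the weak integral \<open>\<integral> A e\<^bsup>-sA\<^esup> f(s) ds\<close>. Pairing with \<open>h\<close> moves the operator to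
  \<open>A\<^sup>* e\<^bsup>-sA\<^sup>*\<^esup> h\<close>, so the Cauchy--Schwarz inequality, the quadratic estimate and the Riesz theorem give
  existence of \<open>B f\<close> and \<open>\<parallel>B f\<parallel> \<le> C \<parallel>f\<parallel>\<close>. In \<open>M\<^sub>- f = M f + e\<^bsup>-tA\<^esup> B f\<close>, where \<open>M\<close> is the given bounded
  extension, the first summand lies in \<open>L\<^sup>2(dt/t)\<close> and hence has vanishing dyadic means, while the
  second is bounded and converges to \<open>B f\<close> at \<open>0\<close>. Every claim then reduces to \<open>B f = 0\<close>. The
  quadratic estimate refers to the semigroup generated by \<open>-A\<^sup>*\<close>; it consists of the adjoints
  \<open>(e\<^bsup>-tA\<^esup>)\<^sup>*\<close>.\<close>

section \<open>Complex Hilbert spaces\<close>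

text \<open>The integrand \<open>A_exp A s (f s)\<close> need not be absolutely integrable in norm
  near \<open>0\<close> or at infinity. Tested against \<open>h\<close> it is: the weights
  \<open>s^(-1/2)\<close> and \<open>s^(1/2)\<close> put \<open>f\<close> in its weighted norm and
  leave exactly the quadratic estimate at \<open>h\<close>. Norm integrability is therefore used
  only on intervals away from \<open>0\<close>, and the full integral exists as a representing
  vector. As \<open>'h\<close> may be nonseparable, vector integrals are compared through scalar
  products with fixed vectors, and norm bounds are recovered by testing a vector against itself.
  \<open>exp_neg\<close> is a definite description, so \<open>A_exp (adj A)\<close> has no content
  until an analytic semigroup with negative generator \<open>adj A\<close> is exhibited and shown
  unique. The candidate is the family of adjoints. Its delicate axiom is strong continuity at
  \<open>0\<close>, since adjoints preserve operator norms but not strong limits. The operators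
  \<open>A e^(-tA)\<close>, \<open>t > 0\<close>, are handled as derivatives of the semigroup, up to
  sign: these are bounded, and the semigroup law moves them to a fixed base time.\<close>

lemma scaleC_zero_left [simp]: "0 *\<^sub>C x = (0::'h::complex_hilbert)"
  using scaleC_of_real[of 0 x] by simp

lemma scaleC_zero_right [simp]: "c *\<^sub>C (0::'h::complex_hilbert) = 0"
  using scaleC_add_right[of c 0 "0::'h"] by simp

lemma scaleC_minus_right: "c *\<^sub>C (- x) = - (c *\<^sub>C (x::'h::complex_hilbert))"
  using scaleC_add_right[of c x "- x"] by (simp add: eq_neg_iff_add_eq_0 add.commute)

lemma scaleC_diff_right: "c *\<^sub>C (x - y) = c *\<^sub>C x - c *\<^sub>C (y::'h::complex_hilbert)"
  using scaleC_add_right[of c x "- y"] by (simp add: scaleC_minus_right)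

lemma scaleC_scaleR_commute: "c *\<^sub>C (r *\<^sub>R x) = r *\<^sub>R (c *\<^sub>C (x::'h::complex_hilbert))"
  by (simp flip: scaleC_of_real add: scaleC_scaleC mult.commute)

lemma cinner_zero_left [simp]: "cinner 0 (y::'h::complex_hilbert) = 0"
  using cinner_scaleC_left[of 0 0 y] by simp

lemma cinner_zero_right [simp]: "cinner (x::'h::complex_hilbert) 0 = 0"
  using cinner_commute[of x 0] by simp

lemma cinner_add_right: "cinner x (y + z) = cinner x y + cinner x (z::'h::complex_hilbert)"
  by (metis cinner_add_left cinner_commute complex_cnj_add)

lemma cinner_scaleC_right: "cinner x (c *\<^sub>C y) = cnj c * cinner x (y::'h::complex_hilbert)"
  by (metis cinner_scaleC_left cinner_commute complex_cnj_mult)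

lemma cinner_scaleR_left: "cinner (r *\<^sub>R x) y = of_real r * cinner x (y::'h::complex_hilbert)"
  by (simp flip: scaleC_of_real add: cinner_scaleC_left)

lemma cinner_scaleR_right: "cinner x (r *\<^sub>R y) = of_real r * cinner x (y::'h::complex_hilbert)"
  by (simp flip: scaleC_of_real add: cinner_scaleC_right)

lemma cinner_minus_left: "cinner (- x) y = - cinner x (y::'h::complex_hilbert)"
  using cinner_scaleR_left[of "-1" x y] by simp

lemma cinner_minus_right: "cinner x (- y) = - cinner x (y::'h::complex_hilbert)"
  using cinner_scaleR_right[of x "-1" y] by simp

lemma cinner_diff_left: "cinner (x - y) z = cinner x z - cinner y (z::'h::complex_hilbert)"
  using cinner_add_left[of x "- y" z] by (simp add: cinner_minus_left)

lemma cinner_diff_right: "cinner x (y - z) = cinner x y - cinner x (z::'h::complex_hilbert)"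
  using cinner_add_right[of x y "- z"] by (simp add: cinner_minus_right)

lemma norm_sq_eq_cinner: "(norm (x::'h::complex_hilbert))\<^sup>2 = Re (cinner x x)"
  by (simp add: cinner_self)

lemma norm_scaleC: "norm (c *\<^sub>C x) = cmod c * norm (x::'h::complex_hilbert)"
proof -
  have "cinner (c *\<^sub>C x) (c *\<^sub>C x) = (c * cnj c) * cinner x x"
    by (simp add: cinner_scaleC_left cinner_scaleC_right)
  also have "c * cnj c = of_real ((cmod c)\<^sup>2)"
    using complex_norm_square[of c] by simp
  finally have "(norm (c *\<^sub>C x))\<^sup>2 = (cmod c * norm x)\<^sup>2"
    unfolding cinner_self of_real_mult[symmetric] of_real_eq_iff power_mult_distrib .
  then show ?thesis
    by (simp add: power2_eq_iff_nonneg)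
qed

lemma Re_cinner_commute: "Re (cinner y x) = Re (cinner x (y::'h::complex_hilbert))"
  by (subst cinner_commute) simp

lemma norm_add_sq:
  "(norm (x + y))\<^sup>2 = (norm x)\<^sup>2 + 2 * Re (cinner x y) + (norm (y::'h::complex_hilbert))\<^sup>2"
  using Re_cinner_commute[of y x]
  by (simp add: norm_sq_eq_cinner cinner_add_left cinner_add_right)

lemma norm_diff_sq:
  "(norm (x - y))\<^sup>2 = (norm x)\<^sup>2 - 2 * Re (cinner x y) + (norm (y::'h::complex_hilbert))\<^sup>2"
  using Re_cinner_commute[of y x]
  by (simp add: norm_sq_eq_cinner cinner_diff_left cinner_diff_right)

lemma cinner_Cauchy_Schwarz: "cmod (cinner x y) \<le> norm x * norm (y::'h::complex_hilbert)"
proof (cases "y = 0")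
  case False
  define c where "c = cinner x y"
  \<comment> \<open>\<open>d *\<^sub>C y\<close> is the orthogonal projection of \<open>x\<close>
    onto the line through \<open>y\<close>; nonnegativity of the squared distance from
    \<open>x\<close> to it is the claim.\<close>
  define d where "d = c / of_real ((norm y)\<^sup>2)"
  have ny: "(norm y)\<^sup>2 > 0" using False by simp
  have "cinner x (d *\<^sub>C y) = of_real ((cmod c)\<^sup>2 / (norm y)\<^sup>2)"
    unfolding cinner_scaleC_right d_def c_def[symmetric]
    using complex_norm_square[of c] by (simp add: mult.commute)
  then have re: "Re (cinner x (d *\<^sub>C y)) = (cmod c)\<^sup>2 / (norm y)\<^sup>2"
    by (metis Re_complex_of_real)
  have "norm (d *\<^sub>C y) = cmod c / norm y"
    using False by (simp add: d_def norm_scaleC norm_divide norm_mult power2_eq_square)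
  then have nd: "(norm (d *\<^sub>C y))\<^sup>2 = (cmod c)\<^sup>2 / (norm y)\<^sup>2"
    by (simp add: power_divide)
  have "0 \<le> (norm (x - d *\<^sub>C y))\<^sup>2" by simp
  also have "\<dots> = (norm x)\<^sup>2 - (cmod c)\<^sup>2 / (norm y)\<^sup>2"
    unfolding norm_diff_sq re nd by simp
  finally have "(cmod c)\<^sup>2 \<le> (norm x * norm y)\<^sup>2"
    using ny by (simp add: field_simps power_mult_distrib)
  then show ?thesis
    unfolding c_def by (rule power2_le_imp_le) simp
qed simp

lemma cinner_eqI: "(\<And>h. cinner x h = cinner y h) \<Longrightarrow> x = (y::'h::complex_hilbert)"
proof -
  assume "\<And>h. cinner x h = cinner y h"
  then have "cinner (x - y) (x - y) = 0" by (simp add: cinner_diff_left)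
  then show ?thesis by (simp add: cinner_self)
qed

lemma cinner_eqI2: "(\<And>h. cinner h x = cinner h y) \<Longrightarrow> x = (y::'h::complex_hilbert)"
  by (rule cinner_eqI) (metis cinner_commute)

text \<open>Take \<open>h = x\<close> and cancel \<open>norm x\<close>. This turns scalar estimates
  for vectors known by their pairings, such as adjoints and integrals, back into norm
  estimates.\<close>

lemma norm_le_cinnerI:
  fixes x :: "'h::complex_hilbert"
  assumes "0 \<le> K" "\<And>h. cmod (cinner x h) \<le> K * norm h"
  shows "norm x \<le> K"
proof (cases "x = 0")
  case False
  have "(norm x)\<^sup>2 \<le> K * norm x"
    using assms(2)[of x] by (simp add: cinner_self norm_power)
  then show ?thesis
    using False by (simp add: power2_eq_square)
qed (simp add: assms)

lemma bounded_bilinear_cinner: "bounded_bilinear (cinner :: 'h::complex_hilbert \<Rightarrow> 'h \<Rightarrow> complex)"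
proof
  show "\<exists>K. \<forall>x y::'h. cmod (cinner x y) \<le> norm x * norm y * K"
    by (rule exI[of _ 1]) (simp add: cinner_Cauchy_Schwarz)
  show "cinner (r *\<^sub>R x) y = r *\<^sub>R cinner x y" for r and x y :: 'h
    unfolding scaleR_conv_of_real by (rule cinner_scaleR_left)
  show "cinner x (r *\<^sub>R y) = r *\<^sub>R cinner x y" for r and x y :: 'h
    unfolding scaleR_conv_of_real by (rule cinner_scaleR_right)
qed (rule cinner_add_left cinner_add_right)+

lemmas bounded_linear_cinner_left = bounded_bilinear.bounded_linear_left[OF bounded_bilinear_cinner]

lemmas tendsto_cinner [tendsto_intros] = bounded_bilinear.tendsto[OF bounded_bilinear_cinner]

lemma bounded_linear_scaleC_right: "bounded_linear (\<lambda>x::'h::complex_hilbert. c *\<^sub>C x)"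
  by (rule bounded_linear_intro[where K = "cmod c"])
    (auto simp: scaleC_add_right scaleC_scaleR_commute norm_scaleC)

section \<open>Riesz representation and orthogonality on closed subspaces\<close>

definition closed_csubspace :: "'h::complex_hilbert set \<Rightarrow> bool" where
  "closed_csubspace V \<longleftrightarrow> closed V \<and> 0 \<in> V \<and> (\<forall>x\<in>V. \<forall>y\<in>V. x + y \<in> V) \<and> (\<forall>c. \<forall>x\<in>V. c *\<^sub>C x \<in> V)"

text \<open>The representing vector minimizes \<open>\<parallel>x\<parallel>\<^sup>2 - 2 Re (\<phi> x)\<close>.\<close>

lemma riesz_representation:
  fixes \<phi> :: "'h::complex_hilbert \<Rightarrow> complex"
  assumes V: "closed_csubspace V"
    and add: "\<And>x y. x \<in> V \<Longrightarrow> y \<in> V \<Longrightarrow> \<phi> (x + y) = \<phi> x + \<phi> y"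
    and scale: "\<And>c x. x \<in> V \<Longrightarrow> \<phi> (c *\<^sub>C x) = c * \<phi> x"
    and bnd: "\<And>x. x \<in> V \<Longrightarrow> cmod (\<phi> x) \<le> K * norm x"
  obtains y where "y \<in> V" "\<And>x. x \<in> V \<Longrightarrow> \<phi> x = cinner x y"
proof -
  have V0: "0 \<in> V" and Va: "\<And>x y. x \<in> V \<Longrightarrow> y \<in> V \<Longrightarrow> x + y \<in> V"
    and Vc: "\<And>c x. x \<in> V \<Longrightarrow> c *\<^sub>C x \<in> V" and Vcl: "closed V"
    using V by (auto simp: closed_csubspace_def)
  have Vr: "r *\<^sub>R x \<in> V" if "x \<in> V" for r x using Vc[OF that, of "of_real r"] by (simp add: scaleC_of_real)
  have Vd: "x - y \<in> V" if "x \<in> V" "y \<in> V" for x y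
    using Va[OF that(1) Vr[OF that(2), of "-1"]] by simp
  have scaleR: "\<phi> (r *\<^sub>R x) = of_real r * \<phi> x" if "x \<in> V" for r x
    using scale[OF that, of "of_real r"] by (simp add: scaleC_of_real)
  have diff: "\<phi> (x - y) = \<phi> x - \<phi> y" if "x \<in> V" "y \<in> V" for x y
    using add[OF that(1) Vr[OF that(2), of "-1"]] scaleR[OF that(2), of "-1"] by simp
  define J where "J x = (norm x)\<^sup>2 - 2 * Re (\<phi> x)" for x
  \<comment> \<open>Completing the square in \<open>norm x - K\<close> bounds \<open>J\<close>
    below, so its infimum over \<open>V\<close> is finite.\<close>
  have Jlow: "- (K\<^sup>2) \<le> J x" if "x \<in> V" for x
  proof -
    have "Re (\<phi> x) \<le> K * norm x" using bnd[OF that] complex_Re_le_cmod order_trans by blast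
    moreover have "0 \<le> (norm x - K)\<^sup>2" by simp
    ultimately show ?thesis unfolding J_def by (simp add: power2_diff mult.commute)
  qed
  define m where "m = Inf (J ` V)"
  have bdd: "bdd_below (J ` V)" using Jlow by (auto intro!: bdd_belowI)
  have mle: "m \<le> J x" if "x \<in> V" for x
    unfolding m_def using bdd that by (intro cInf_lower) auto
  have "\<exists>x\<in>V. J x < m + 1 / real (Suc n)" for n
    using cInf_lessD[of "J ` V" "m + 1 / real (Suc n)"] V0 by (auto simp: m_def)
  then obtain x where xV: "\<And>n. x n \<in> V" and xJ: "\<And>n. J (x n) < m + 1 / real (Suc n)" by metis
  \<comment> \<open>Parallelogram law; the linear terms of \<open>J\<close> cancel. The midpoint
    lies in \<open>V\<close> and has value at least \<open>m\<close>, so two near minimizers must be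
    close.\<close>
  have para: "(norm (u - v))\<^sup>2 = 2 * J u + 2 * J v - 4 * J ((1/2) *\<^sub>R (u + v))" if "u \<in> V" "v \<in> V" for u v
    unfolding J_def scaleR[OF Va[OF that]] add[OF that] norm_diff_sq
    by (simp add: power_mult_distrib norm_add_sq cinner_scaleR_left cinner_scaleR_right power2_eq_square[of 2] field_simps)
  have cau: "(norm (x n - x k))\<^sup>2 \<le> 2 / real (Suc n) + 2 / real (Suc k)" for n k
    using para[OF xV xV, of n k] mle[OF Vr[OF Va[OF xV xV]], of "1/2" n k] xJ[of n] xJ[of k] by simp
  have "Cauchy x"
  proof (rule metric_CauchyI)
    fix e :: real assume e: "0 < e"
    obtain N where N: "4 / e\<^sup>2 < real (Suc N)" using reals_Archimedean2 less_SucI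
      by (metis lessI less_trans of_nat_less_iff)
    have "dist (x n) (x k) < e" if "n \<ge> N" "k \<ge> N" for n k
    proof -
      have "2 / real (Suc n) \<le> 2 / real (Suc N)" "2 / real (Suc k) \<le> 2 / real (Suc N)"
        using that by (auto intro!: divide_left_mono)
      then have "(norm (x n - x k))\<^sup>2 \<le> 4 / real (Suc N)" using cau[of n k] by simp
      also have "\<dots> < e\<^sup>2" using N e by (simp add: field_simps)
      finally show ?thesis using e by (simp add: dist_norm power_less_imp_less_base)
    qed
    then show "\<exists>M. \<forall>m\<ge>M. \<forall>n\<ge>M. dist (x m) (x n) < e" by blast
  qed
  then obtain y where y: "x \<longlonglongrightarrow> y" using Cauchy_convergent convergent_def by blast
  have yV: "y \<in> V" using Vcl y xV by (metis closed_sequentially)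
  have "(\<lambda>n. \<phi> (x n)) \<longlonglongrightarrow> \<phi> y"
  proof -
    have "(\<lambda>n. \<phi> (x n) - \<phi> y) \<longlonglongrightarrow> 0"
    proof (rule Lim_null_comparison)
      show "\<forall>\<^sub>F n in sequentially. norm (\<phi> (x n) - \<phi> y) \<le> K * norm (x n - y)"
        using bnd[OF Vd[OF xV yV]] diff[OF xV yV] by simp
      show "(\<lambda>n. K * norm (x n - y)) \<longlonglongrightarrow> 0"
        using y by (auto intro!: tendsto_eq_intros simp: LIM_zero_iff)
    qed
    then show ?thesis by (simp add: LIM_zero_iff)
  qed
  then have "(\<lambda>n. J (x n)) \<longlonglongrightarrow> J y" unfolding J_def by (intro tendsto_intros y)
  moreover have "(\<lambda>n. m + 1 / real (Suc n)) \<longlonglongrightarrow> m"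
    using tendsto_add[OF tendsto_const LIMSEQ_inverse_real_of_nat, of m] by (simp add: inverse_eq_divide)
  ultimately have "J y \<le> m" using xJ less_imp_le by (blast intro: LIMSEQ_le)
  then have min: "J y \<le> J v" if "v \<in> V" for v using mle[OF that] by simp
  have Re_eq: "Re (cinner y v) = Re (\<phi> v)" if v: "v \<in> V" for v
  proof -
    \<comment> \<open>\<open>2 * a\<close> is the derivative of
      \<open>t \<mapsto> J (y + t *\<^sub>R v)\<close> at \<open>0\<close>, which must vanish at a
      minimizer.\<close>
    define a where "a = Re (cinner y v) - Re (\<phi> v)"
    have *: "0 \<le> 2 * t * a + t\<^sup>2 * (norm v)\<^sup>2" for t
    proof -
      have "J (y + t *\<^sub>R v) = J y + 2 * t * a + t\<^sup>2 * (norm v)\<^sup>2"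
        unfolding J_def add[OF yV Vr[OF v]] scaleR[OF v] norm_add_sq a_def
        by (simp add: cinner_scaleR_right power_mult_distrib algebra_simps)
      then show ?thesis using min[OF Va[OF yV Vr[OF v]], of t] by simp
    qed
    have "a = 0"
    proof (rule ccontr)
      assume "a \<noteq> 0"
      \<comment> \<open>At \<open>t = - a / b\<close> the quadratic is negative if \<open>a\<close>
        is nonzero; the summand \<open>1\<close> keeps \<open>b\<close> positive also for
        \<open>v = 0\<close>.\<close>
      define b where "b = (norm v)\<^sup>2 + 1"
      have b: "b > 0" by (simp add: b_def add_nonneg_pos)
      have nv: "(norm v)\<^sup>2 = b - 1" by (simp add: b_def)
      have "2 * (- a / b) * a + (- a / b)\<^sup>2 * (norm v)\<^sup>2 = - a\<^sup>2 / b - a\<^sup>2 / b\<^sup>2"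
        unfolding nv using b by (simp add: field_simps power2_eq_square)
      moreover have "a\<^sup>2 / b > 0" "a\<^sup>2 / b\<^sup>2 > 0" using \<open>a \<noteq> 0\<close> b by auto
      ultimately show False using *[of "- a / b"] by simp
    qed
    then show ?thesis by (simp add: a_def)
  qed
  have "\<phi> v = cinner v y" if v: "v \<in> V" for v
  proof (rule complex_eqI)
    show "Re (\<phi> v) = Re (cinner v y)" using Re_eq[OF v] Re_cinner_commute[of v y] by simp
    \<comment> \<open>The real-part identity at \<open>\<i> *\<^sub>C v\<close> is, up to sign, the
      imaginary part at \<open>v\<close>; here complex homogeneity of \<open>V\<close> and
      \<open>\<phi>\<close> enters.\<close>
    show "Im (\<phi> v) = Im (cinner v y)"
      using Re_eq[OF Vc[OF v, of \<i>]] Re_cinner_commute[of "\<i> *\<^sub>C v" y] 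
      by (simp add: scale[OF v] cinner_scaleC_left)
  qed
  with yV that show thesis by blast
qed

text \<open>The functional \<open>v \<mapsto> cinner v x\<close> on \<open>V\<close> is represented
  by some \<open>y\<close> in \<open>V\<close>, the projection of \<open>x\<close>. The remainder
  \<open>x - y\<close> is orthogonal to \<open>V\<close>, hence zero.\<close>

lemma csubspace_eq_UNIV:
  fixes V :: "'h::complex_hilbert set"
  assumes V: "closed_csubspace V" and orth: "\<And>y. (\<And>x. x \<in> V \<Longrightarrow> cinner x y = 0) \<Longrightarrow> y = 0"
  shows "V = UNIV"
proof -
  have "x \<in> V" for x
  proof -
    obtain y where y: "y \<in> V" "\<And>v. v \<in> V \<Longrightarrow> cinner v x = cinner v y"
    proof (rule riesz_representation[OF V])
      show "cmod (cinner v x) \<le> norm x * norm v" for v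
        using cinner_Cauchy_Schwarz[of v x] by (simp add: mult.commute)
    qed (auto simp: cinner_add_left cinner_scaleC_left)
    have "x - y = 0" by (rule orth) (simp add: cinner_diff_right y)
    with y show ?thesis by simp
  qed
  then show ?thesis by auto
qed

section \<open>Adjoints of bounded operators\<close>

lemma bounded_clinearD:
  assumes "bounded_clinear U"
  shows "bounded_linear U" "U (c *\<^sub>C x) = c *\<^sub>C U x"
  using assms by (auto simp: bounded_clinear_def)

text \<open>The adjoint of an everywhere defined bounded operator, as a function; \<open>adj\<close>
  is its counterpart for graphs. The description is meaningful by \<open>cinner_cadj\<close>, where
  the Riesz theorem supplies existence.\<close>

definition cadj :: "('h::complex_hilbert \<Rightarrow> 'h) \<Rightarrow> 'h \<Rightarrow> 'h" where
  "cadj U y = (THE z. \<forall>x. cinner (U x) y = cinner x z)"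

lemma cadj_eqI:
  assumes "\<And>x. cinner (U x) y = cinner x z" shows "cadj U y = (z::'h::complex_hilbert)"
  unfolding cadj_def
proof (rule the_equality)
  show "w = z" if "\<forall>x. cinner (U x) y = cinner x w" for w
    by (rule cinner_eqI2) (metis assms that)
qed (simp add: assms)

lemma cinner_cadj:
  assumes U: "bounded_clinear U"
  shows "cinner (U x) y = cinner x (cadj U (y::'h::complex_hilbert))"
proof -
  interpret bounded_linear U using U by (rule bounded_clinearD)
  obtain K where K: "\<And>x. norm (U x) \<le> norm x * K" using bounded by blast
  obtain z where "\<And>x. cinner (U x) y = cinner x z"
  proof (rule riesz_representation[of UNIV "\<lambda>x. cinner (U x) y" "K * norm y"])
    show "cmod (cinner (U x) y) \<le> (K * norm y) * norm x" for x
      using cinner_Cauchy_Schwarz[of "U x" y] mult_right_mono[OF K[of x], of "norm y"]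
      by (simp add: mult.commute mult.left_commute)
  qed (auto simp: closed_csubspace_def add cinner_add_left cinner_scaleC_left bounded_clinearD(2)[OF U])
  then show ?thesis using cadj_eqI by metis
qed

lemma norm_cadj_le:
  assumes U: "bounded_clinear U" and K: "0 \<le> K" "\<And>x. norm (U x) \<le> K * norm x"
  shows "norm (cadj U y) \<le> K * norm (y::'h::complex_hilbert)"
proof (rule norm_le_cinnerI)
  fix h
  have "cmod (cinner (cadj U y) h) = cmod (cinner (U h) y)"
    unfolding cinner_cadj[OF U] by (subst cinner_commute) simp
  also have "\<dots> \<le> norm (U h) * norm y" by (rule cinner_Cauchy_Schwarz)
  also have "\<dots> \<le> K * norm h * norm y" by (intro mult_right_mono K) simp
  finally show "cmod (cinner (cadj U y) h) \<le> K * norm y * norm h" by (simp add: ac_simps)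
qed (simp add: K)

lemma bounded_clinear_cadj:
  assumes U: "bounded_clinear U"
  shows "bounded_clinear (cadj U)"
proof -
  have "bounded_linear (cadj U)"
  proof (rule bounded_linear_intro)
    show "cadj U (x + y) = cadj U x + cadj U y" for x y
      by (rule cadj_eqI) (simp add: cinner_add_right cinner_cadj[OF U])
    show "cadj U (r *\<^sub>R x) = r *\<^sub>R cadj U x" for r x
      by (rule cadj_eqI) (simp add: cinner_scaleR_right cinner_cadj[OF U])
    show "norm (cadj U x) \<le> norm x * onorm U" for x
      using norm_cadj_le[OF U onorm_pos_le onorm] bounded_clinearD[OF U] by (simp add: mult.commute)
  qed
  moreover have "cadj U (c *\<^sub>C x) = c *\<^sub>C cadj U x" for c x
    by (rule cadj_eqI) (simp add: cinner_scaleC_right cinner_cadj[OF U])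
  ultimately show ?thesis by (simp add: bounded_clinear_def)
qed

lemma cadj_compose:
  "bounded_clinear U \<Longrightarrow> bounded_clinear W \<Longrightarrow> cadj (U \<circ> W) = cadj W \<circ> cadj U"
  by (rule ext, rule cadj_eqI) (simp add: cinner_cadj)

lemma onorm_cadj_le:
  assumes U: "bounded_clinear U" shows "onorm (cadj U) \<le> onorm U"
  using norm_cadj_le[OF U onorm_pos_le onorm] bounded_clinearD[OF U] by (intro onorm_bound onorm_pos_le) auto

section \<open>Strong measurability and strong integrals\<close>

text \<open>Strong measurability is an almost everywhere limit, so completeness is what turns it
  into Borel measurability of norms and scalar products.\<close>

lemma complete_measure_lebesgue_on:
  assumes "S \<in> sets lebesgue" shows "complete_measure (lebesgue_on S)"
proof
  fix A B assume "B \<subseteq> A" "A \<in> null_sets (lebesgue_on S)"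
  then have "B \<subseteq> S" "B \<in> null_sets lebesgue"
    using assms completion.complete2[of B A] by (auto simp: null_sets_restrict_space)
  then have "B \<in> null_sets (lebesgue_on S)"
    using assms by (simp add: null_sets_restrict_space)
  then show "B \<in> sets (lebesgue_on S)" by auto
qed

lemma (in complete_measure) borel_measurable_AE_cong:
  fixes f g :: "'a \<Rightarrow> 'b::topological_space"
  assumes f: "f \<in> borel_measurable M" and ae: "AE x in M. f x = g x"
  shows "g \<in> borel_measurable M"
proof (rule measurableI)
  fix A :: "'b set" assume "A \<in> sets borel"
  then have fA: "f -` A \<inter> space M \<in> sets M" using f by (rule measurable_sets[rotated])
  have "AE x in M. x \<in> f -` A \<inter> space M \<longleftrightarrow> x \<in> g -` A \<inter> space M"
    using ae by eventually_elim simp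
  then show "g -` A \<inter> space M \<in> sets M"
    using fA by (rule in_sets_AE) simp
qed simp

lemma strongly_measurable_simple: "simple_function M f \<Longrightarrow> strongly_measurable M f"
  unfolding strongly_measurable_def by (rule exI[of _ "\<lambda>_. f"]) simp

lemma strongly_measurable_borel:
  fixes f :: "'a \<Rightarrow> 'b::{real_normed_vector, second_countable_topology}"
  assumes "f \<in> borel_measurable M" shows "strongly_measurable M f"
proof -
  obtain F where "\<forall>i. simple_function M (F i)" "\<forall>x\<in>space M. (\<lambda>i. F i x) \<longlonglongrightarrow> f x"
    using borel_measurable_implies_sequence_metric[OF assms, of 0] by blast
  then show ?thesis
    unfolding strongly_measurable_def by (intro exI[of _ F] conjI AE_I2) auto
qed

text \<open>Apply \<open>H\<close> to the approximating simple functions. Continuity is required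
  only at the points \<open>(f x, g x)\<close>: for \<open>H = A_exp (neg_generator S)\<close> the
  approximants of the time variable may be nonpositive, and only their limit is known to be
  positive.\<close>

lemma strongly_measurable_compose2:
  assumes f: "strongly_measurable M f" and g: "strongly_measurable M g"
    and H: "\<And>x u v. x \<in> space M \<Longrightarrow> u \<longlonglongrightarrow> f x \<Longrightarrow> v \<longlonglongrightarrow> g x \<Longrightarrow>
      (\<lambda>i::nat. H (u i) (v i)) \<longlonglongrightarrow> H (f x) (g x)"
  shows "strongly_measurable M (\<lambda>x. H (f x) (g x))"
proof -
  obtain s where s: "\<And>i. simple_function M (s i)" "AE x in M. (\<lambda>i. s i x) \<longlonglongrightarrow> f x"
    using f by (auto simp: strongly_measurable_def)
  obtain t where t: "\<And>i. simple_function M (t i)" "AE x in M. (\<lambda>i. t i x) \<longlonglongrightarrow> g x"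
    using g by (auto simp: strongly_measurable_def)
  have "AE x in M. (\<lambda>i. H (s i x) (t i x)) \<longlonglongrightarrow> H (f x) (g x)"
    using AE_space s(2) t(2) by eventually_elim (rule H)
  moreover have "simple_function M (\<lambda>x. H (s i x) (t i x))" for i
    by (rule simple_function_compose2[OF s(1) t(1)])
  ultimately show ?thesis
    unfolding strongly_measurable_def by (intro exI[of _ "\<lambda>i x. H (s i x) (t i x)"]) auto
qed

lemma strongly_measurable_compose:
  assumes f: "strongly_measurable M f"
    and H: "\<And>x u. x \<in> space M \<Longrightarrow> u \<longlonglongrightarrow> f x \<Longrightarrow> (\<lambda>i::nat. H (u i)) \<longlonglongrightarrow> H (f x)"
  shows "strongly_measurable M (\<lambda>x. H (f x))"
  using strongly_measurable_compose2[OF f f, of "\<lambda>a b. H a"] H by blast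

lemma strongly_measurable_add:
  "strongly_measurable M f \<Longrightarrow> strongly_measurable M g \<Longrightarrow> strongly_measurable M (\<lambda>x. f x + g x)"
  by (erule (1) strongly_measurable_compose2) (rule tendsto_add)

lemma strongly_measurable_diff:
  "strongly_measurable M f \<Longrightarrow> strongly_measurable M g \<Longrightarrow> strongly_measurable M (\<lambda>x. f x - g x)"
  by (erule (1) strongly_measurable_compose2) (rule tendsto_diff)

lemma strongly_measurable_restrict:
  fixes f :: "'a::euclidean_space \<Rightarrow> 'b::real_normed_vector"
  assumes f: "strongly_measurable (lebesgue_on T) f"
    and S: "S \<in> sets lebesgue" and T: "T \<in> sets lebesgue" and "S \<subseteq> T"
  shows "strongly_measurable (lebesgue_on S) f"
proof -
  obtain s where s: "\<And>i. simple_function (lebesgue_on T) (s i)" "AE x in lebesgue_on T. (\<lambda>i. s i x) \<longlonglongrightarrow> f x"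
    using f by (auto simp: strongly_measurable_def)
  have "simple_function (lebesgue_on S) (s i)" for i
  proof -
    have "s i -` {y} \<inter> S = (s i -` {y} \<inter> T) \<inter> S" for y using \<open>S \<subseteq> T\<close> by auto
    moreover have "s i -` {s i x} \<inter> T \<in> sets lebesgue" if "x \<in> T" for x
      using s(1)[of i] T that unfolding simple_function_def by (auto simp: sets_restrict_space_iff)
    moreover have "finite (s i ` S)"
      using s(1)[of i] \<open>S \<subseteq> T\<close> T unfolding simple_function_def
      by (auto intro: finite_subset[OF image_mono])
    ultimately show ?thesis
      using S \<open>S \<subseteq> T\<close> unfolding simple_function_def by (auto simp: sets_restrict_space_iff)
  qed
  moreover have "AE x in lebesgue_on S. (\<lambda>i. s i x) \<longlonglongrightarrow> f x"
    using s(2) S T \<open>S \<subseteq> T\<close> by (auto simp: AE_restrict_space_iff elim!: eventually_mono)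
  ultimately show ?thesis by (auto simp: strongly_measurable_def)
qed

section \<open>Strong measurability and strong integrals over a complete measure\<close>

context complete_measure
begin

lemma borel_measurable_strongly_measurable:
  fixes f :: "'a \<Rightarrow> 'b::{real_normed_vector, second_countable_topology}"
  assumes "strongly_measurable M f" shows "f \<in> borel_measurable M"
proof -
  obtain s where s: "\<And>i. simple_function M (s i)" "AE x in M. (\<lambda>i. s i x) \<longlonglongrightarrow> f x"
    using assms by (auto simp: strongly_measurable_def)
  obtain N where N: "N \<in> null_sets M" "\<And>x. x \<in> space M \<Longrightarrow> x \<notin> N \<Longrightarrow> (\<lambda>i. s i x) \<longlonglongrightarrow> f x"
    using s(2) by (auto elim!: AE_E3)
  have [measurable]: "N \<in> sets M" using N by auto
  have [measurable]: "s i \<in> borel_measurable M" for i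
    by (rule borel_measurable_simple_function[OF s(1)])
  \<comment> \<open>Cutting off at the exceptional null set makes the limit hold everywhere;
    completeness then restores the values of \<open>f\<close> on \<open>N\<close>.\<close>
  have "(\<lambda>x. indicator (- N) x *\<^sub>R f x) \<in> borel_measurable M"
  proof (rule borel_measurable_LIMSEQ_metric)
    show "(\<lambda>x. indicator (space M - N) x *\<^sub>R s i x) \<in> borel_measurable M" for i by measurable
    show "(\<lambda>i. indicator (space M - N) x *\<^sub>R s i x) \<longlonglongrightarrow> indicator (- N) x *\<^sub>R f x" if "x \<in> space M" for x
      using N(2)[OF that] that by (auto simp: indicator_def)
  qed
  then show ?thesis
  proof (rule borel_measurable_AE_cong)
    show "AE x in M. indicator (- N) x *\<^sub>R f x = f x"
      using AE_not_in[OF N(1)] by eventually_elim simp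
  qed
qed

lemma borel_measurable_norm_strongly_measurable:
  "strongly_measurable M f \<Longrightarrow> (\<lambda>x. norm (f x)) \<in> borel_measurable M"
  by (rule borel_measurable_strongly_measurable, erule strongly_measurable_compose) (rule tendsto_norm)

text \<open>The approximating simple functions are cut off where they exceed twice the norm of
  \<open>f\<close>. Dominated convergence then gives convergence in the mean, so their integrals
  form a Cauchy sequence.\<close>

lemma has_strong_integral_exists:
  fixes f :: "'a \<Rightarrow> 'b::banach"
  assumes f: "strongly_measurable M f" and fin: "(\<integral>\<^sup>+x. ennreal (norm (f x)) \<partial>M) < \<infinity>"
  shows "\<exists>y. has_strong_integral M f y"
proof -
  obtain s where s: "\<And>i. simple_function M (s i)" "AE x in M. (\<lambda>i. s i x) \<longlonglongrightarrow> f x"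
    using f by (auto simp: strongly_measurable_def)
  have nf [measurable]: "(\<lambda>x. norm (f x)) \<in> borel_measurable M"
    using f by (rule borel_measurable_norm_strongly_measurable)
  have sm: "strongly_measurable M (s i)" for i by (rule strongly_measurable_simple[OF s(1)])
  have ns [measurable]: "(\<lambda>x. norm (s i x)) \<in> borel_measurable M" for i
    using sm by (rule borel_measurable_norm_strongly_measurable)
  \<comment> \<open>The factor \<open>2\<close> leaves room: where \<open>f x\<close> is nonzero,
    \<open>norm (s i x) < 2 * norm (f x)\<close> holds eventually and the cut-off becomes inactive;
    where \<open>f x = 0\<close>, it forces the value \<open>0\<close>.\<close>
  define A where "A i = {x \<in> space M. norm (s i x) \<le> 2 * norm (f x)}" for i
  have A [measurable]: "A i \<in> sets M" for i unfolding A_def by measurable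
  define t where "t i x = indicat_real (A i) x *\<^sub>R s i x" for i x
  have t: "simple_function M (t i)" for i
    unfolding t_def by (rule simple_function_compose2[OF simple_function_indicator[OF A] s(1)])
  have tle: "norm (t i x) \<le> 2 * norm (f x)" for i x
    by (auto simp: t_def A_def indicator_def)
  have "AE x in M. (\<lambda>i. t i x) \<longlonglongrightarrow> f x"
    using s(2) AE_space
  proof eventually_elim
    case (elim x)
    show ?case
    proof (cases "f x = 0")
      case True
      then have "t i x = 0" for i using tle[of i x] by simp
      then show ?thesis using True by simp
    next
      case False
      have "\<forall>\<^sub>F i in sequentially. norm (s i x) < 2 * norm (f x)"
        using order_tendstoD(2)[OF tendsto_norm[OF elim(1)], of "2 * norm (f x)"] False by simp
      then have "\<forall>\<^sub>F i in sequentially. s i x = t i x"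
        by (rule eventually_mono) (use elim(2) in \<open>auto simp: t_def A_def\<close>)
      with elim(1) show ?thesis by (rule Lim_transform_eventually)
    qed
  qed
  then have tf: "AE x in M. (\<lambda>i. ennreal (norm (f x - t i x))) \<longlonglongrightarrow> 0"
    by eventually_elim (auto intro!: tendsto_eq_intros)
  have ntm [measurable]: "(\<lambda>x. norm (f x - t i x)) \<in> borel_measurable M" for i
    by (intro borel_measurable_norm_strongly_measurable strongly_measurable_diff f strongly_measurable_simple t)
  \<comment> \<open>Majorant for \<open>norm (f x - t i x)\<close>: one part for \<open>f x\<close>
    and two for \<open>t i x\<close>.\<close>
  have fin3: "(\<integral>\<^sup>+x. 3 * ennreal (norm (f x)) \<partial>M) < \<infinity>"
    using fin by (simp add: nn_integral_cmult ennreal_mult_less_top)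
  have L1: "(\<lambda>i. \<integral>\<^sup>+x. ennreal (norm (f x - t i x)) \<partial>M) \<longlonglongrightarrow> (\<integral>\<^sup>+x. 0 \<partial>M)"
  proof (rule nn_integral_dominated_convergence[OF _ _ _ _ fin3 tf])
    have "norm (f x - t i x) \<le> 3 * norm (f x)" for i x
      using norm_triangle_ineq4[of "f x" "t i x"] tle[of i x] by simp
    then have "ennreal (norm (f x - t i x)) \<le> ennreal (3 * norm (f x))" for i x
      by (rule ennreal_leI)
    then show "AE x in M. ennreal (norm (f x - t j x)) \<le> 3 * ennreal (norm (f x))" for j
      by (simp add: ennreal_mult)
  qed auto
  have sbi: "Bochner_Integration.simple_bochner_integrable M (t i)" for i
  proof (rule simple_bochner_integrableI_bounded[OF t])
    have "(\<integral>\<^sup>+x. norm (t i x) \<partial>M) \<le> (\<integral>\<^sup>+x. 2 * ennreal (norm (f x)) \<partial>M)"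
      using tle by (intro nn_integral_mono) (metis ennreal_leI ennreal_mult ennreal_numeral norm_ge_zero zero_le_numeral)
    also have "\<dots> < \<infinity>" using fin by (simp add: nn_integral_cmult ennreal_mult_less_top)
    finally show "(\<integral>\<^sup>+x. norm (t i x) \<partial>M) < \<infinity>" .
  qed
  define I where "I i = Bochner_Integration.simple_bochner_integral M (t i)" for i
  define e where "e i = (\<integral>\<^sup>+x. ennreal (norm (f x - t i x)) \<partial>M)" for i
  have e0: "e \<longlonglongrightarrow> 0" using L1 unfolding e_def by simp
  have dist_I: "ennreal (norm (I i - I j)) \<le> e i + e j" for i j
  proof -
    have d: "Bochner_Integration.simple_bochner_integrable M (\<lambda>x. t i x - t j x)"
      by (rule simple_bochner_integrable_compose2[of "(-)"]) (auto simp: sbi)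
    have "ennreal (norm (I i - I j)) = norm (Bochner_Integration.simple_bochner_integral M (\<lambda>x. t i x - t j x))"
      unfolding I_def by (simp add: simple_bochner_integral_diff sbi)
    also have "\<dots> \<le> Bochner_Integration.simple_bochner_integral M (\<lambda>x. norm (t i x - t j x))"
      using simple_bochner_integral_norm_bound[OF d] by (rule ennreal_leI)
    also have "\<dots> = (\<integral>\<^sup>+x. norm (t i x - t j x) \<partial>M)"
      using simple_bochner_integrable_compose2[of "\<lambda>x y. norm (x - y)" M "t i" "t j"] sbi
      by (intro simple_bochner_integral_eq_nn_integral) auto
    also have "\<dots> \<le> (\<integral>\<^sup>+x. ennreal (norm (f x - t i x)) + ennreal (norm (f x - t j x)) \<partial>M)"
    proof (rule nn_integral_mono)
      fix x
      have "norm (t i x - t j x) \<le> norm (f x - t i x) + norm (f x - t j x)"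
        by (metis norm_diff_triangle_le norm_minus_commute order_refl)
      then show "ennreal (norm (t i x - t j x)) \<le> ennreal (norm (f x - t i x)) + ennreal (norm (f x - t j x))"
        by (metis ennreal_leI ennreal_plus norm_ge_zero)
    qed
    also have "\<dots> = e i + e j" unfolding e_def by (rule nn_integral_add) auto
    finally show ?thesis .
  qed
  have "Cauchy I"
  proof (rule metric_CauchyI)
    fix r :: real assume r: "0 < r"
    then have "\<forall>\<^sub>F i in sequentially. e i < ennreal (r / 2)"
      using order_tendstoD(2)[OF e0, of "ennreal (r / 2)"] by simp
    then obtain N where N: "\<And>i. i \<ge> N \<Longrightarrow> e i < ennreal (r / 2)"
      by (auto simp: eventually_sequentially)
    have "dist (I i) (I j) < r" if "i \<ge> N" "j \<ge> N" for i j
    proof -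
      have "ennreal (norm (I i - I j)) < ennreal (r / 2) + ennreal (r / 2)"
        using dist_I[of i j] add_strict_mono[OF N[OF that(1)] N[OF that(2)]] by (rule order.strict_trans1)
      also have "\<dots> = ennreal r" using r by (simp flip: ennreal_plus)
      finally show ?thesis by (simp add: dist_norm ennreal_less_iff)
    qed
    then show "\<exists>M. \<forall>m\<ge>M. \<forall>n\<ge>M. dist (I m) (I n) < r" by blast
  qed
  then obtain y where "I \<longlonglongrightarrow> y" using Cauchy_convergent convergent_def by blast
  then show ?thesis
    unfolding has_strong_integral_def using f sbi e0 by (auto simp: I_def[abs_def] e_def[abs_def] intro!: exI[of _ t])
qed

text \<open>Pairing with \<open>h\<close> is bounded and linear in the first argument, so it carries
  the approximation in the definition over to complex values, where ordinary Bochner integration is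
  available.\<close>

lemma has_strong_integral_cinner:
  fixes f :: "'a \<Rightarrow> 'h::complex_hilbert"
  assumes "has_strong_integral M f y"
  shows "has_bochner_integral M (\<lambda>x. cinner (f x) h) (cinner y h)"
proof -
  obtain s where f: "strongly_measurable M f" and s: "\<And>i. Bochner_Integration.simple_bochner_integrable M (s i)"
    and L1: "(\<lambda>i. \<integral>\<^sup>+x. ennreal (norm (f x - s i x)) \<partial>M) \<longlonglongrightarrow> 0"
    and lim: "(\<lambda>i. Bochner_Integration.simple_bochner_integral M (s i)) \<longlonglongrightarrow> y"
    using assms by (auto simp: has_strong_integral_def)
  have [measurable]: "(\<lambda>x. norm (f x - s i x)) \<in> borel_measurable M" for i
    using s[of i] by (intro borel_measurable_norm_strongly_measurable strongly_measurable_diff f strongly_measurable_simple)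
      (simp add: Bochner_Integration.simple_bochner_integrable.simps)
  show ?thesis
  proof (rule has_bochner_integral.intros)
    show "(\<lambda>x. cinner (f x) h) \<in> borel_measurable M"
      by (rule borel_measurable_strongly_measurable, rule strongly_measurable_compose[OF f])
        (rule tendsto_cinner[OF _ tendsto_const])
    show "Bochner_Integration.simple_bochner_integrable M (\<lambda>x. cinner (s i x) h)" for i
      by (rule simple_bochner_integrable_compose2[where p = "\<lambda>u v. cinner u h", OF _ s s]) simp
    show "(\<lambda>i. \<integral>\<^sup>+ x. ennreal (norm (cinner (f x) h - cinner (s i x) h)) \<partial>M) \<longlonglongrightarrow> 0"
    proof (rule tendsto_sandwich[OF always_eventually always_eventually tendsto_const])
      show "\<forall>i. (\<integral>\<^sup>+ x. ennreal (norm (cinner (f x) h - cinner (s i x) h)) \<partial>M)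
        \<le> ennreal (norm h) * (\<integral>\<^sup>+ x. ennreal (norm (f x - s i x)) \<partial>M)"
      proof
        fix i
        have "norm (cinner (f x) h - cinner (s i x) h) \<le> norm h * norm (f x - s i x)" for x
          using cinner_Cauchy_Schwarz[of "f x - s i x" h] by (simp add: cinner_diff_left mult.commute)
        then have "(\<integral>\<^sup>+ x. ennreal (norm (cinner (f x) h - cinner (s i x) h)) \<partial>M)
          \<le> (\<integral>\<^sup>+ x. ennreal (norm h) * ennreal (norm (f x - s i x)) \<partial>M)"
          by (intro nn_integral_mono) (simp add: ennreal_leI flip: ennreal_mult)
        also have "\<dots> = ennreal (norm h) * (\<integral>\<^sup>+ x. ennreal (norm (f x - s i x)) \<partial>M)"
          by (rule nn_integral_cmult) measurable
        finally show "(\<integral>\<^sup>+ x. ennreal (norm (cinner (f x) h - cinner (s i x) h)) \<partial>M)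
          \<le> ennreal (norm h) * (\<integral>\<^sup>+ x. ennreal (norm (f x - s i x)) \<partial>M)" .
      qed
      show "(\<lambda>i. ennreal (norm h) * (\<integral>\<^sup>+ x. ennreal (norm (f x - s i x)) \<partial>M)) \<longlonglongrightarrow> 0"
        using ennreal_tendsto_cmult[OF _ L1, of "ennreal (norm h)"] by simp
    qed simp
    have "Bochner_Integration.simple_bochner_integral M (\<lambda>x. cinner (s i x) h) = cinner (Bochner_Integration.simple_bochner_integral M (s i)) h" for i
      by (rule simple_bochner_integral_linear[OF bounded_linear.linear[OF bounded_linear_cinner_left] s])
    then show "(\<lambda>i. Bochner_Integration.simple_bochner_integral M (\<lambda>x. cinner (s i x) h)) \<longlonglongrightarrow> cinner y h"
      using lim by (auto intro!: tendsto_intros)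
  qed
qed

end

text \<open>Pairings with all \<open>h\<close> determine a strong integral, hence it is unique;
  existence comes from absolute integrability. So the description in \<open>strong_integral\<close>
  picks the actual integral.\<close>

lemma strong_integral_cinner:
  fixes f :: "real \<Rightarrow> 'h::complex_hilbert"
  assumes S: "S \<in> sets lebesgue" and f: "strongly_measurable (lebesgue_on S) f"
    and fin: "(\<integral>\<^sup>+x. ennreal (norm (f x)) \<partial>lebesgue_on S) < \<infinity>"
  shows "has_bochner_integral (lebesgue_on S) (\<lambda>x. cinner (f x) h) (cinner (strong_integral S f) h)"
proof -
  interpret complete_measure "lebesgue_on S" by (rule complete_measure_lebesgue_on[OF S])
  have "\<exists>!y. has_strong_integral (lebesgue_on S) f y"
    using has_strong_integral_exists[OF f fin]
    by (metis cinner_eqI has_strong_integral_cinner has_bochner_integral_eq)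
  then have "has_strong_integral (lebesgue_on S) f (strong_integral S f)"
    unfolding strong_integral_def using theI'[of "has_strong_integral (lebesgue_on S) f"] by (simp add: ex1_implies_ex)
  then show ?thesis by (rule has_strong_integral_cinner)
qed

text \<open>The intervals exhaust the half line, so dominated convergence applies. The lemma serves
  both the means over \<open>[\<tau>, 2\<tau>]\<close> and the two-sided truncation in the weak
  integral.\<close>

lemma nn_integral_tail:
  fixes \<phi> :: "real \<Rightarrow> ennreal"
  assumes [measurable]: "\<phi> \<in> borel_measurable (lebesgue_on {0<..})"
    and fin: "(\<integral>\<^sup>+x. \<phi> x \<partial>lebesgue_on {0<..}) < \<infinity>" and "0 < e"
  obtains n where "(\<integral>\<^sup>+x. \<phi> x * indicator (- {1 / real (Suc n)..real (Suc n)}) x \<partial>lebesgue_on {0<..}) < e"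
proof -
  let ?A = "\<lambda>n. {1 / real (Suc n)..real (Suc n)}"
  have meas: "- ?A n \<inter> {0<..} \<in> sets (lebesgue_on {0<..})" for n
    by (auto simp: sets_restrict_space_iff)
  have "(\<lambda>n. \<integral>\<^sup>+x. \<phi> x * indicator (- ?A n) x \<partial>lebesgue_on {0<..}) \<longlonglongrightarrow> (\<integral>\<^sup>+x. 0 \<partial>lebesgue_on {0::real<..})"
  proof (rule nn_integral_dominated_convergence[where w = \<phi>])
    show "(\<lambda>x. \<phi> x * indicator (- ?A n) x) \<in> borel_measurable (lebesgue_on {0<..})" for n
      using meas[of n] by (intro borel_measurable_times_ennreal borel_measurable_indicator') (auto simp: Int_def conj_commute)
    show "AE x in lebesgue_on {0<..}. \<phi> x * indicator (- ?A n) x \<le> \<phi> x" for n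
      by (auto simp: indicator_def)
    show "AE x in lebesgue_on {0<..}. (\<lambda>n. \<phi> x * indicator (- ?A n) x) \<longlonglongrightarrow> 0"
    proof (rule AE_I2)
      fix x :: real assume "x \<in> space (lebesgue_on {0<..})"
      then have x: "0 < x" by simp
      obtain N where N: "max x (1 / x) \<le> real N" using real_arch_simple by blast
      have "\<forall>\<^sub>F n in sequentially. \<phi> x * indicator (- ?A n) x = 0"
        using eventually_ge_at_top[of N]
      proof eventually_elim
        case (elim n)
        then have "max x (1 / x) \<le> real (Suc n)" using N by simp
        then have "x \<in> ?A n" using x by (auto simp: field_simps)
        then show ?case by simp
      qed
      then show "(\<lambda>n. \<phi> x * indicator (- ?A n) x) \<longlonglongrightarrow> 0" by (rule tendsto_eventually)
    qed
  qed (use fin in auto)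
  then have "\<forall>\<^sub>F n in sequentially. (\<integral>\<^sup>+x. \<phi> x * indicator (- ?A n) x \<partial>lebesgue_on {0<..}) < e"
    using \<open>0 < e\<close> by (intro order_tendstoD(2)[of _ 0]) auto
  then show thesis using that by (auto simp: eventually_sequentially)
qed

section \<open>Bounded analytic semigroups\<close>

lemma has_vector_derivative_iff_quotient:
  "(f has_vector_derivative D) (at x) \<longleftrightarrow> ((\<lambda>r. (1 / (r - x)) *\<^sub>R (f r - f x)) \<longlongrightarrow> D) (at x)"
proof -
  have "\<forall>\<^sub>F r in at x. norm (f r - f x - (r - x) *\<^sub>R D) / norm (r - x) = norm ((1 / (r - x)) *\<^sub>R (f r - f x) - D)"
    unfolding eventually_at_filter
  proof (intro always_eventually allI impI)
    fix r assume "r \<noteq> x"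
    then have "(1 / (r - x)) *\<^sub>R (f r - f x) - D = (1 / (r - x)) *\<^sub>R (f r - f x - (r - x) *\<^sub>R D)"
      by (simp add: scaleR_diff_right)
    then show "norm (f r - f x - (r - x) *\<^sub>R D) / norm (r - x) = norm ((1 / (r - x)) *\<^sub>R (f r - f x) - D)"
      by simp
  qed
  from tendsto_cong[OF this] show ?thesis
    unfolding has_vector_derivative_def has_derivative_iff_norm
    by (simp add: bounded_linear_scaleR_left tendsto_norm_zero_iff LIM_zero_iff)
qed

lemma of_real_mem_sector: "0 < t \<Longrightarrow> 0 < \<delta> \<Longrightarrow> complex_of_real t \<in> sector \<delta>"
  by (simp add: sector_def)

lemma cnj_mem_sector: "z \<in> sector \<delta> \<Longrightarrow> cnj z \<in> sector \<delta>"
  by (auto simp: sector_def Arg_cnj)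

text \<open>\<open>Arg\<close> is continuous off the nonpositive reals, and
  \<open>\<delta> < pi\<close> keeps \<open>z\<close> off them. Hence limits at a point of the
  sector see only values of the semigroup inside it.\<close>

lemma eventually_mem_sector:
  assumes "z \<in> sector \<delta>" "\<delta> < pi"
  shows "\<forall>\<^sub>F w in nhds z. w \<in> sector \<delta>"
proof -
  have z: "z \<noteq> 0" "\<bar>Arg z\<bar> < \<delta>" using assms by (auto simp: sector_def)
  have "z \<notin> \<real>\<^sub>\<le>\<^sub>0"
  proof
    assume "z \<in> \<real>\<^sub>\<le>\<^sub>0"
    then obtain r where "z = of_real r" "r \<le> 0" by (auto elim: nonpos_Reals_cases)
    with z assms show False by (auto split: if_splits)
  qed
  then have "isCont (\<lambda>w. \<bar>Arg w\<bar>) z" by (intro continuous_intros continuous_at_Arg)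
  then have "((\<lambda>w. \<bar>Arg w\<bar>) \<longlongrightarrow> \<bar>Arg z\<bar>) (nhds z)" by (simp add: isCont_def tendsto_at_iff_tendsto_nhds[of "\<lambda>w. \<bar>Arg w\<bar>"])
  then have "\<forall>\<^sub>F w in nhds z. \<bar>Arg w\<bar> < \<delta>" using z by (intro order_tendstoD)
  moreover have "\<forall>\<^sub>F w in nhds z. w \<noteq> 0" using z(1) by (rule t1_space_nhds)
  ultimately show ?thesis by eventually_elim (simp add: sector_def)
qed

text \<open>Needed because \<open>onorm\<close> bounds the values of a map only if that map is known
  to be bounded and linear.\<close>

lemma bounded_clinear_quotient:
  fixes U W D :: "'h::complex_hilbert \<Rightarrow> 'h"
  assumes "bounded_clinear U" "bounded_clinear W" "bounded_clinear D"
  shows "bounded_clinear (\<lambda>x. c *\<^sub>C (U x - W x) - D x)"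
proof -
  have "bounded_linear (\<lambda>x. c *\<^sub>C (U x - W x) - D x)"
    using assms
    by (intro bounded_linear_sub bounded_linear_compose[OF bounded_linear_scaleC_right]) (auto simp: bounded_clinear_def)
  then show ?thesis
    using assms by (simp add: bounded_clinear_def scaleC_diff_right scaleC_scaleC mult.commute)
qed

locale analytic_semigroup =
  fixes \<delta> :: real and S :: "complex \<Rightarrow> 'h::complex_hilbert \<Rightarrow> 'h"
  assumes \<delta>_pos: "0 < \<delta>" and \<delta>_less: "\<delta> < pi / 2"
    and semigroup: "bdd_analytic_semigroup \<delta> S"
begin

abbreviation T :: "real \<Rightarrow> 'h \<Rightarrow> 'h" where "T t \<equiv> S (complex_of_real t)"

lemma real_mem_sector: "0 < t \<Longrightarrow> complex_of_real t \<in> sector \<delta>"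
  by (rule of_real_mem_sector[OF _ \<delta>_pos])

lemma S_0: "S 0 = id"
  using semigroup by (simp add: bdd_analytic_semigroup_def)

lemma bounded_clinear_S: "z \<in> sector \<delta> \<Longrightarrow> bounded_clinear (S z)"
  using semigroup by (simp add: bdd_analytic_semigroup_def)

lemma S_add: "z \<in> sector \<delta> \<Longrightarrow> w \<in> sector \<delta> \<Longrightarrow> S (z + w) x = S z (S w x)"
  using semigroup by (simp add: bdd_analytic_semigroup_def)

lemma S_at_0: "((\<lambda>z. S z x) \<longlongrightarrow> x) (at 0 within sector \<delta>)"
  using semigroup by (simp add: bdd_analytic_semigroup_def)

lemma linear_S: "z \<in> sector \<delta> \<Longrightarrow> linear (S z)"
  using bounded_clinear_S bounded_clinearD(1) bounded_linear.linear by blast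

lemma T_add: "0 \<le> t \<Longrightarrow> 0 \<le> s \<Longrightarrow> T (t + s) x = T t (T s x)"
  by (cases "t = 0"; cases "s = 0") (simp_all add: S_0 S_add real_mem_sector)

lemma linear_T: "0 \<le> t \<Longrightarrow> linear (T t)"
  by (cases "t = 0") (simp_all add: S_0 linear_S real_mem_sector linear_id[unfolded id_def] id_def)

text \<open>A bound of at least \<open>1\<close> also covers \<open>T 0 = id\<close>; the point
  \<open>0\<close> is not in the sector.\<close>

definition B where "B = (SOME B. 1 \<le> B \<and> (\<forall>z\<in>sector \<delta>. \<forall>x. norm (S z x) \<le> B * norm x))"

lemma B: "1 \<le> B" "z \<in> sector \<delta> \<Longrightarrow> norm (S z x) \<le> B * norm x"
proof -
  obtain b where b: "\<And>z x. z \<in> sector \<delta> \<Longrightarrow> norm (S z x) \<le> b * norm x"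
    using semigroup unfolding bdd_analytic_semigroup_def by meson
  have "norm (S z x) \<le> max 1 b * norm x" if "z \<in> sector \<delta>" for z x
    using b[OF that, of x] mult_right_mono[of b "max 1 b" "norm x"] by simp
  then have "\<exists>B\<ge>1. \<forall>z\<in>sector \<delta>. \<forall>x. norm (S z x) \<le> B * norm x"
    by (intro exI[of _ "max 1 b"]) auto
  from someI_ex[OF this] show "1 \<le> B" "z \<in> sector \<delta> \<Longrightarrow> norm (S z x) \<le> B * norm x"
    unfolding B_def by auto
qed

lemma norm_T_le: "0 \<le> t \<Longrightarrow> norm (T t x) \<le> B * norm x"
  using B(2)[OF real_mem_sector, of t x] mult_right_mono[OF B(1), of "norm x"] by (cases "t = 0") (auto simp: S_0)

text \<open>The complex derivative of the semigroup in operator norm. For \<open>t > 0\<close> it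
  turns out to be \<open>- A e^(-tA)\<close>, see \<open>A_exp_eq\<close>.\<close>

definition D where
  "D z = (SOME D. bounded_clinear D \<and>
     ((\<lambda>w. onorm (\<lambda>x. inverse (w - z) *\<^sub>C (S w x - S z x) - D x)) \<longlongrightarrow> 0) (at z))"

lemma D:
  assumes "z \<in> sector \<delta>"
  shows "bounded_clinear (D z)"
    "((\<lambda>w. onorm (\<lambda>x. inverse (w - z) *\<^sub>C (S w x - S z x) - D z x)) \<longlongrightarrow> 0) (at z)"
proof -
  have "\<exists>D. bounded_clinear D \<and>
     ((\<lambda>w. onorm (\<lambda>x. inverse (w - z) *\<^sub>C (S w x - S z x) - D x)) \<longlongrightarrow> 0) (at z)"
    using semigroup assms by (simp add: bdd_analytic_semigroup_def)
  from someI_ex[OF this] show "bounded_clinear (D z)"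
    "((\<lambda>w. onorm (\<lambda>x. inverse (w - z) *\<^sub>C (S w x - S z x) - D z x)) \<longlongrightarrow> 0) (at z)"
    unfolding D_def by auto
qed

lemma eventually_sector_at: "z \<in> sector \<delta> \<Longrightarrow> \<forall>\<^sub>F w in at z. w \<in> sector \<delta>"
  using eventually_mem_sector[of z \<delta>] \<delta>_less pi_gt_zero
  by (auto simp: eventually_at_filter elim!: eventually_mono)

lemma quotient_tendsto_D:
  assumes z: "z \<in> sector \<delta>"
  shows "((\<lambda>w. inverse (w - z) *\<^sub>C (S w x - S z x)) \<longlongrightarrow> D z x) (at z)"
proof -
  have "((\<lambda>w. inverse (w - z) *\<^sub>C (S w x - S z x) - D z x) \<longlongrightarrow> 0) (at z)"
  proof (rule Lim_null_comparison)
    show "\<forall>\<^sub>F w in at z. norm (inverse (w - z) *\<^sub>C (S w x - S z x) - D z x)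
      \<le> onorm (\<lambda>x. inverse (w - z) *\<^sub>C (S w x - S z x) - D z x) * norm x"
      using eventually_sector_at[OF z]
    proof eventually_elim
      case (elim w)
      show ?case
        by (rule onorm, rule bounded_clinearD, rule bounded_clinear_quotient)
          (use elim z D bounded_clinear_S in auto)
    qed
    show "((\<lambda>w. onorm (\<lambda>x. inverse (w - z) *\<^sub>C (S w x - S z x) - D z x) * norm x) \<longlongrightarrow> 0) (at z)"
      using tendsto_mult_right[OF D(2)[OF z], of "norm x"] by simp
  qed
  then show ?thesis by (simp add: LIM_zero_iff)
qed

lemma isCont_S:
  assumes z: "z \<in> sector \<delta>" shows "isCont (\<lambda>w. S w x) z"
proof -
  have "((\<lambda>w. S w x - S z x) \<longlongrightarrow> 0) (at z)"
  proof (rule Lim_null_comparison)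
    show "\<forall>\<^sub>F w in at z. norm (S w x - S z x) \<le> cmod (w - z) * norm (inverse (w - z) *\<^sub>C (S w x - S z x))"
      unfolding eventually_at_filter
      by (intro always_eventually) (simp add: norm_scaleC norm_inverse mult.assoc[symmetric])
    show "((\<lambda>w. cmod (w - z) * norm (inverse (w - z) *\<^sub>C (S w x - S z x))) \<longlongrightarrow> 0) (at z)"
      by (rule tendsto_eq_intros quotient_tendsto_D z refl | simp)+
  qed
  then show ?thesis by (simp add: isCont_def LIM_zero_iff)
qed

lemma T_has_vector_derivative:
  assumes "0 < t" shows "((\<lambda>r. T r x) has_vector_derivative D (complex_of_real t) x) (at t)"
proof -
  have "filterlim complex_of_real (at (complex_of_real t)) (at t)"
    by (auto simp: filterlim_at eventually_at_filter intro!: tendsto_of_real)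
  from filterlim_compose[OF quotient_tendsto_D[OF real_mem_sector[OF assms]] this]
  show ?thesis
    unfolding has_vector_derivative_iff_quotient
    by (simp add: inverse_eq_divide scaleC_of_real[symmetric] del: scaleC_of_real)
qed

lemma continuous_on_T: "continuous_on {0..} (\<lambda>t. T t x)"
  unfolding continuous_on_def
proof
  fix t :: real assume "t \<in> {0..}"
  show "((\<lambda>t. T t x) \<longlongrightarrow> T t x) (at t within {0..})"
  proof (cases "t = 0")
    case True
    have "filterlim complex_of_real (at 0 within sector \<delta>) (at 0 within {0..})"
      using tendsto_of_real[of "\<lambda>x. x" 0 "at 0 within {0..}"]
      by (auto simp: filterlim_at eventually_at_filter real_mem_sector less_le)
    from filterlim_compose[OF S_at_0 this] show ?thesis by (simp add: True S_0)
  next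
    case False
    then have "0 < t" using \<open>t \<in> {0..}\<close> by simp
    then have "isCont (\<lambda>t. T t x) t"
      using isCont_o2[OF isCont_of_real[OF continuous_ident] isCont_S[OF real_mem_sector]] by simp
    then show ?thesis unfolding isCont_def by (rule tendsto_within_subset) simp
  qed
qed

text \<open>Joint continuity in time and vector: the uniform bound \<open>B\<close> absorbs the
  variation of the vector, strong continuity that of the time.\<close>

lemma tendsto_T:
  assumes "(u \<longlongrightarrow> t) F" "(v \<longlongrightarrow> x) F" "0 \<le> t" "\<forall>\<^sub>F i in F. 0 \<le> u i"
  shows "((\<lambda>i. T (u i) (v i)) \<longlongrightarrow> T t x) F"
proof -
  have "((\<lambda>i. T (u i) (v i) - T (u i) x) \<longlongrightarrow> 0) F"
  proof (rule Lim_null_comparison)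
    show "\<forall>\<^sub>F i in F. norm (T (u i) (v i) - T (u i) x) \<le> B * norm (v i - x)"
      using assms(4)
    proof eventually_elim
      case (elim i)
      then show ?case using norm_T_le[of "u i" "v i - x"] by (simp add: linear_diff[OF linear_T])
    qed
    show "((\<lambda>i. B * norm (v i - x)) \<longlongrightarrow> 0) F"
      using tendsto_mult_right_zero[OF tendsto_norm_zero[OF LIM_zero[OF assms(2)]]] .
  qed
  moreover have "((\<lambda>i. T (u i) x) \<longlongrightarrow> T t x) F"
    using assms by (intro continuous_on_tendsto_compose[OF continuous_on_T]) auto
  ultimately show ?thesis using tendsto_add by fastforce
qed

text \<open>Differentiate \<open>T r x = T (r - s) (T s x)\<close> in \<open>r\<close> at
  \<open>t + s\<close>. The derivative at any later time thus factors through the one at a fixed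
  time.\<close>

lemma D_add:
  assumes "0 < t" "0 \<le> s" shows "D (complex_of_real (t + s)) x = D (complex_of_real t) (T s x)"
proof (rule vector_derivative_unique_at)
  show "((\<lambda>r. T r x) has_vector_derivative D (complex_of_real (t + s)) x) (at (t + s))"
    using assms by (intro T_has_vector_derivative) simp
  have "((\<lambda>r. T r (T s x)) \<circ> (\<lambda>r. r - s) has_vector_derivative 1 *\<^sub>R D (complex_of_real t) (T s x)) (at (t + s))"
    using T_has_vector_derivative[OF assms(1), of "T s x"]
    by (intro vector_diff_chain_at) (auto intro!: derivative_eq_intros)
  then have "((\<lambda>r. T r (T s x)) \<circ> (\<lambda>r. r - s) has_vector_derivative D (complex_of_real t) (T s x)) (at (t + s))"
    by simp
  then show "((\<lambda>r. T r x) has_vector_derivative D (complex_of_real t) (T s x)) (at (t + s))"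
  proof (rule has_vector_derivative_transform_within_open[where S = "{s<..}"])
    show "((\<lambda>r. T r (T s x)) \<circ> (\<lambda>r. r - s)) r = T r x" if "r \<in> {s<..}" for r
      using that assms T_add[of "r - s" s x] by (simp add: o_def)
  qed (use assms in auto)
qed

lemma norm_D_le:
  assumes "0 < a" "a \<le> t"
  shows "norm (D (complex_of_real t) x) \<le> onorm (D (complex_of_real a)) * B * norm x"
proof -
  have bl: "bounded_linear (D (complex_of_real a))"
    using D(1)[OF real_mem_sector[OF assms(1)]] by (rule bounded_clinearD)
  have "norm (D (complex_of_real t) x) \<le> onorm (D (complex_of_real a)) * norm (T (t - a) x)"
    using D_add[OF assms(1), of "t - a" x] assms onorm[OF bl] by simp
  also have "\<dots> \<le> onorm (D (complex_of_real a)) * (B * norm x)"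
    using assms by (intro mult_left_mono norm_T_le onorm_pos_le[OF bl]) auto
  finally show ?thesis by (simp add: mult.assoc)
qed

text \<open>Once \<open>u i > t / 2\<close>, the operator \<open>D\<close> at \<open>u i\<close> is
  the fixed bounded operator \<open>D\<close> at \<open>t / 2\<close> after
  \<open>T (u i - t / 2)\<close>, so joint continuity reduces to that of \<open>T\<close>.\<close>

lemma tendsto_D:
  assumes u: "(u \<longlongrightarrow> t) F" and v: "(v \<longlongrightarrow> x) F" and "0 < t"
  shows "((\<lambda>i. D (complex_of_real (u i)) (v i)) \<longlongrightarrow> D (complex_of_real t) x) F"
proof -
  have a: "0 < t / 2" using \<open>0 < t\<close> by simp
  have ev: "\<forall>\<^sub>F i in F. t / 2 < u i" by (rule order_tendstoD(1)[OF u]) (use \<open>0 < t\<close> in simp)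
  have bl: "bounded_linear (D (complex_of_real (t / 2)))"
    using D(1)[OF real_mem_sector[OF a]] by (rule bounded_clinearD)
  have "((\<lambda>i. T (u i - t / 2) (v i)) \<longlongrightarrow> T (t - t / 2) x) F"
    using ev \<open>0 < t\<close> by (intro tendsto_T tendsto_diff u v) (auto elim: eventually_mono)
  then have "((\<lambda>i. D (complex_of_real (t / 2)) (T (u i - t / 2) (v i))) \<longlongrightarrow> D (complex_of_real (t / 2)) (T (t - t / 2) x)) F"
    by (rule bounded_linear.tendsto[OF bl])
  moreover have "D (complex_of_real (t / 2)) (T (t - t / 2) x) = D (complex_of_real t) x"
    using D_add[OF a, of "t - t / 2" x] \<open>0 < t\<close> by simp
  moreover have "\<forall>\<^sub>F i in F. D (complex_of_real (t / 2)) (T (u i - t / 2) (v i)) = D (complex_of_real (u i)) (v i)"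
    using ev
  proof eventually_elim
    case (elim i)
    then show ?case using D_add[OF a, of "u i - t / 2" "v i"] by simp
  qed
  ultimately show ?thesis using Lim_transform_eventually by force
qed

lemma T_quotient_at_right:
  assumes "0 < t"
  shows "((\<lambda>h. (1 / h) *\<^sub>R (T (t + h) x - T t x)) \<longlongrightarrow> D (complex_of_real t) x) (at_right 0)"
proof -
  have "filterlim (\<lambda>h. t + h) (at t) (at_right 0)"
    by (auto simp: filterlim_at eventually_at_filter intro!: tendsto_eq_intros)
  from filterlim_compose[OF T_has_vector_derivative[OF assms, unfolded has_vector_derivative_iff_quotient] this]
  show ?thesis by simp
qed

section \<open>Relation of the derivative to the generator\<close>

lemma T_mem_generator:
  assumes "0 < t" shows "(T t x, - D (complex_of_real t) x) \<in> neg_generator S"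
proof -
  have "\<forall>\<^sub>F h in at_right 0. - ((1 / h) *\<^sub>R (T (t + h) x - T t x)) = (1 / h) *\<^sub>R (T t x - T h (T t x))"
    unfolding eventually_at_filter
  proof (intro always_eventually allI impI)
    fix h :: real assume "h \<in> {0<..}"
    then show "- ((1 / h) *\<^sub>R (T (t + h) x - T t x)) = (1 / h) *\<^sub>R (T t x - T h (T t x))"
      using assms T_add[of h t x] by (simp add: scaleR_diff_right add.commute)
  qed
  from Lim_transform_eventually[OF tendsto_minus[OF T_quotient_at_right[OF assms]] this]
  show ?thesis by (simp add: neg_generator_def)
qed

text \<open>The generator commutes with the semigroup on its domain: applying \<open>T t\<close> to
  the quotient that defines \<open>v\<close> gives minus the right difference quotient of
  \<open>r \<mapsto> T r y\<close> at \<open>t\<close>.\<close>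

lemma D_generator:
  assumes "(y, v) \<in> neg_generator S" "0 < t" shows "D (complex_of_real t) y = - T t v"
proof -
  have bl: "bounded_linear (T t)"
    using bounded_clinear_S[OF real_mem_sector[OF assms(2)]] by (rule bounded_clinearD)
  have "((\<lambda>h. T t ((1 / h) *\<^sub>R (y - T h y))) \<longlongrightarrow> T t v) (at_right 0)"
    using assms(1) by (intro bounded_linear.tendsto[OF bl]) (simp add: neg_generator_def)
  moreover have "\<forall>\<^sub>F h in at_right 0. T t ((1 / h) *\<^sub>R (y - T h y)) = - ((1 / h) *\<^sub>R (T (t + h) y - T t y))"
    unfolding eventually_at_filter
  proof (intro always_eventually allI impI)
    fix h :: real assume "h \<in> {0<..}"
    then show "T t ((1 / h) *\<^sub>R (y - T h y)) = - ((1 / h) *\<^sub>R (T (t + h) y - T t y))"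
      using assms(2) T_add[of t h y] linear_T[of t]
      by (simp add: linear_cmul linear_diff scaleR_diff_right)
  qed
  ultimately have "((\<lambda>h. - ((1 / h) *\<^sub>R (T (t + h) y - T t y))) \<longlongrightarrow> T t v) (at_right 0)"
    by (rule Lim_transform_eventually)
  from tendsto_unique[OF _ this tendsto_minus[OF T_quotient_at_right[OF assms(2)]]]
  show ?thesis by simp
qed

lemma single_valued_generator: "single_valued (neg_generator S)"
  by (rule single_valuedI) (auto simp: neg_generator_def intro: tendsto_unique[rotated])

end

text \<open>For two semigroups with the same generator, \<open>s \<mapsto> S\<^sub>1 (t - s) S\<^sub>2 s x\<close> has derivative zero.\<close>

lemma semigroup_unique:
  assumes S1: "analytic_semigroup \<delta>1 S1" and S2: "analytic_semigroup \<delta>2 S2"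
    and gen: "neg_generator S1 = neg_generator S2" and t: "0 < t"
  shows "S1 (complex_of_real t) = S2 (complex_of_real t)"
proof
  fix x
  interpret S1: analytic_semigroup \<delta>1 S1 by fact
  interpret S2: analytic_semigroup \<delta>2 S2 by fact
  define \<phi> where "\<phi> s = S1.T (t - s) (S2.T s x)" for s
  have "(\<phi> has_vector_derivative 0) (at s)" if s: "s \<in> {0<..<t}" for s
    unfolding has_vector_derivative_iff_quotient
  proof -
    let ?y = "S2.T s x"
    \<comment> \<open>The quotient of \<open>\<phi>\<close> splits as in the product rule. In this
      term time and vector both move, which calls for joint continuity.\<close>
    have "((\<lambda>r. S1.T (t - r) ((1 / (r - s)) *\<^sub>R (S2.T r x - ?y))) \<longlongrightarrow> S1.T (t - s) (S2.D (complex_of_real s) x)) (at s)"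
    proof (rule S1.tendsto_T)
      show "((\<lambda>r. (1 / (r - s)) *\<^sub>R (S2.T r x - ?y)) \<longlongrightarrow> S2.D (complex_of_real s) x) (at s)"
        using S2.T_has_vector_derivative[of s x] s by (simp add: has_vector_derivative_iff_quotient)
      have "\<forall>\<^sub>F r in at s. r \<in> {0<..<t}" using s by (intro eventually_at_in_open') auto
      then show "\<forall>\<^sub>F r in at s. 0 \<le> t - r" by eventually_elim simp
    qed (use s in \<open>auto intro!: tendsto_intros\<close>)
    moreover have "((\<lambda>r. (1 / (r - s)) *\<^sub>R (S1.T (t - r) ?y - S1.T (t - s) ?y)) \<longlongrightarrow> - S1.D (complex_of_real (t - s)) ?y) (at s)"
    proof -
      have "((\<lambda>r. S1.T r ?y) \<circ> (\<lambda>r. t - r) has_vector_derivative (- 1) *\<^sub>R S1.D (complex_of_real (t - s)) ?y) (at s)"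
        using S1.T_has_vector_derivative[of "t - s" ?y] s
        by (intro vector_diff_chain_at) (auto intro!: derivative_eq_intros)
      then show ?thesis by (simp add: has_vector_derivative_iff_quotient o_def)
    qed
    ultimately have "((\<lambda>r. S1.T (t - r) ((1 / (r - s)) *\<^sub>R (S2.T r x - ?y))
        + (1 / (r - s)) *\<^sub>R (S1.T (t - r) ?y - S1.T (t - s) ?y))
      \<longlongrightarrow> S1.T (t - s) (S2.D (complex_of_real s) x) + - S1.D (complex_of_real (t - s)) ?y) (at s)"
      by (rule tendsto_add)
    \<comment> \<open>The two limits cancel: \<open>S2\<close> maps into the domain of the common
      generator, since \<open>s > 0\<close>, and \<open>S1\<close> commutes with that generator
      there.\<close>
    moreover have "S1.D (complex_of_real (t - s)) ?y = S1.T (t - s) (S2.D (complex_of_real s) x)"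
    proof -
      have "(?y, - S2.D (complex_of_real s) x) \<in> neg_generator S1"
        using S2.T_mem_generator[of s x] s by (simp add: gen)
      from S1.D_generator[OF this, of "t - s"] show ?thesis
        using s linear_neg[OF S1.linear_T, of "t - s"] by simp
    qed
    moreover have "\<forall>\<^sub>F r in at s. S1.T (t - r) ((1 / (r - s)) *\<^sub>R (S2.T r x - ?y))
        + (1 / (r - s)) *\<^sub>R (S1.T (t - r) ?y - S1.T (t - s) ?y) = (1 / (r - s)) *\<^sub>R (\<phi> r - \<phi> s)"
    proof -
      have "\<forall>\<^sub>F r in at s. r \<in> {0<..<t}" using s by (intro eventually_at_in_open') auto
      then show ?thesis
      proof eventually_elim
        case (elim r)
        then have "linear (S1.T (t - r))" by (intro S1.linear_T) simp
        then show ?case by (simp add: \<phi>_def linear_cmul linear_diff scaleR_diff_right)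
      qed
    qed
    ultimately show "((\<lambda>r. (1 / (r - s)) *\<^sub>R (\<phi> r - \<phi> s)) \<longlongrightarrow> 0) (at s)"
      using Lim_transform_eventually by fastforce
  qed
  then have "\<And>s. s \<in> {0<..<t} \<Longrightarrow> (\<phi> has_vector_derivative 0) (at s within {0<..<t})"
    by (rule has_vector_derivative_at_within)
  then obtain c where c: "\<And>s. s \<in> {0<..<t} \<Longrightarrow> \<phi> s = c"
    using has_vector_derivative_zero_constant[of "{0<..<t}" \<phi>] by auto
  \<comment> \<open>Constancy is known only on the open interval; continuity carries it to
    \<open>0\<close> and \<open>t\<close>, where \<open>\<phi>\<close> takes the two values to be
    compared.\<close>
  have lim: "(\<phi> \<longlongrightarrow> \<phi> s) (at s within {0<..<t})" if "0 \<le> s" "s \<le> t" for s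
    unfolding \<phi>_def using that
    by (intro S1.tendsto_T S2.tendsto_T tendsto_intros) (auto simp: eventually_at_filter intro!: tendsto_intros)
  have "\<phi> s = c" if "0 \<le> s" "s \<le> t" "s islimpt {0<..<t}" for s
  proof (rule tendsto_unique[OF _ lim[OF that(1,2)]])
    show "at s within {0<..<t} \<noteq> bot"
      using that(3) by (simp add: trivial_limit_within)
    show "(\<phi> \<longlongrightarrow> c) (at s within {0<..<t})"
      by (rule tendsto_eventually) (auto simp: eventually_at_filter c)
  qed
  from this[of 0] this[of t] t have "\<phi> 0 = \<phi> t"
    by (simp add: islimpt_greaterThanLessThan1 islimpt_greaterThanLessThan2)
  then show "S1.T t x = S2.T t x"
    by (simp add: \<phi>_def S1.S_0 S2.S_0)
qed

text \<open>The description in \<open>exp_neg\<close> admits any sector and any semigroup with the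
  given generator; by \<open>semigroup_unique\<close> they all agree at
  \<open>t > 0\<close>.\<close>

lemma (in analytic_semigroup) exp_neg_eq: "0 < t \<Longrightarrow> exp_neg (neg_generator S) t = T t"
  unfolding exp_neg_def
proof (rule the_equality)
  show "\<exists>\<delta>' S'. 0 < \<delta>' \<and> \<delta>' < pi / 2 \<and> bdd_analytic_semigroup \<delta>' S' \<and> neg_generator S' = neg_generator S \<and> T t = S' (complex_of_real t)"
    using \<delta>_pos \<delta>_less semigroup by blast
qed (metis analytic_semigroup.intro analytic_semigroup_axioms semigroup_unique)

lemma (in analytic_semigroup) A_exp_eq:
  assumes "0 < t" shows "A_exp (neg_generator S) t x = - D (complex_of_real t) x"
  unfolding A_exp_def op_app_def exp_neg_eq[OF assms]
  using T_mem_generator[OF assms, of x] single_valued_generator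
  by (intro the_equality) (auto dest: single_valuedD)

section \<open>The adjoint semigroup\<close>

lemma cinner_cadj_left: "bounded_clinear U \<Longrightarrow> cinner (cadj U x) y = cinner x (U (y::'h::complex_hilbert))"
  by (metis cinner_cadj cinner_commute)

context analytic_semigroup
begin

text \<open>The conjugation makes \<open>z \<mapsto> S_adj z\<close> holomorphic, since taking
  adjoints is conjugate linear. At real times this is the plain adjoint.\<close>

definition S_adj :: "complex \<Rightarrow> 'h \<Rightarrow> 'h" where
  "S_adj z = cadj (S (cnj z))"

lemma bounded_clinear_S_adj: "z \<in> sector \<delta> \<Longrightarrow> bounded_clinear (S_adj z)"
  unfolding S_adj_def by (intro bounded_clinear_cadj bounded_clinear_S cnj_mem_sector)

lemma S_adj_add:
  assumes "z \<in> sector \<delta>" "w \<in> sector \<delta>"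
  shows "S_adj (z + w) = S_adj z \<circ> S_adj w"
proof -
  have "S (cnj (z + w)) = S (cnj w) \<circ> S (cnj z)"
    using S_add[OF cnj_mem_sector[OF assms(2)] cnj_mem_sector[OF assms(1)]] by (auto simp: add.commute)
  then show ?thesis
    unfolding S_adj_def by (simp add: cadj_compose bounded_clinear_S cnj_mem_sector assms)
qed

lemma norm_S_adj_le: "z \<in> sector \<delta> \<Longrightarrow> norm (S_adj z x) \<le> B * norm x"
  unfolding S_adj_def
  by (rule norm_cadj_le) (use B in \<open>auto intro: bounded_clinear_S cnj_mem_sector\<close>)

text \<open>The quotient error for \<open>S_adj\<close> at \<open>w\<close> is the adjoint of the
  one for \<open>S\<close> at \<open>cnj w\<close>, and taking adjoints does not increase the
  operator norm.\<close>

lemma S_adj_deriv: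
  assumes z: "z \<in> sector \<delta>"
  shows "((\<lambda>w. onorm (\<lambda>x. inverse (w - z) *\<^sub>C (S_adj w x - S_adj z x) - cadj (D (cnj z)) x)) \<longlongrightarrow> 0) (at z)"
proof (rule tendsto_sandwich)
  let ?Q = "\<lambda>w x. inverse (w - cnj z) *\<^sub>C (S w x - S (cnj z) x) - D (cnj z) x"
  let ?R = "\<lambda>w x. inverse (w - z) *\<^sub>C (S_adj w x - S_adj z x) - cadj (D (cnj z)) x"
  have bD: "bounded_clinear (D (cnj z))" using D(1) cnj_mem_sector z by blast
  have Q: "bounded_clinear (?Q (cnj w))" if "w \<in> sector \<delta>" for w
    using that z by (intro bounded_clinear_quotient bounded_clinear_S cnj_mem_sector bD)
  have R: "?R w = cadj (?Q (cnj w))" if "w \<in> sector \<delta>" for w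
  proof (rule ext, rule sym, rule cadj_eqI)
    fix y x
    show "cinner (?Q (cnj w) x) y = cinner x (?R w y)"
      using that z bD by (simp add: cinner_diff_left cinner_diff_right cinner_scaleC_left cinner_scaleC_right
          S_adj_def cinner_cadj bounded_clinear_S cnj_mem_sector)
  qed
  have ev: "\<forall>\<^sub>F w in at z. w \<in> sector \<delta>" by (rule eventually_sector_at[OF z])
  show "\<forall>\<^sub>F w in at z. 0 \<le> onorm (?R w)"
    using ev by eventually_elim (simp only: R onorm_pos_le bounded_clinearD bounded_clinear_cadj Q)
  show "\<forall>\<^sub>F w in at z. onorm (?R w) \<le> onorm (?Q (cnj w))"
    using ev by eventually_elim (simp only: R onorm_cadj_le Q)
  have "filterlim cnj (at (cnj z)) (at z)"
    by (auto simp: filterlim_at eventually_at_filter intro!: tendsto_intros)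
  from filterlim_compose[OF D(2)[OF cnj_mem_sector[OF z]] this]
  show "((\<lambda>w. onorm (?Q (cnj w))) \<longlongrightarrow> 0) (at z)" .
qed simp

text \<open>Derived directly from the derivative, because \<open>S_adj\<close> is not yet known to
  satisfy all the semigroup axioms; strong continuity at \<open>0\<close>, proved next, relies on
  this lemma.\<close>

lemma isCont_S_adj:
  assumes z: "z \<in> sector \<delta>" shows "isCont (\<lambda>w. S_adj w x) z"
proof -
  let ?R = "\<lambda>w x. inverse (w - z) *\<^sub>C (S_adj w x - S_adj z x) - cadj (D (cnj z)) x"
  have bD: "bounded_clinear (cadj (D (cnj z)))" by (intro bounded_clinear_cadj D(1) cnj_mem_sector z)
  have "((\<lambda>w. S_adj w x - S_adj z x) \<longlongrightarrow> 0) (at z)"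
  proof (rule Lim_null_comparison)
    show "\<forall>\<^sub>F w in at z. norm (S_adj w x - S_adj z x) \<le> cmod (w - z) * (onorm (?R w) * norm x + norm (cadj (D (cnj z)) x))"
      using eventually_sector_at[OF z] eventually_neq_at_within[of z]
    proof eventually_elim
      case (elim w)
      have "bounded_linear (?R w)"
        using bounded_clinearD(1)[OF bounded_clinear_quotient[OF bounded_clinear_S_adj[OF elim(1)] bounded_clinear_S_adj[OF z] bD]] .
      from onorm[OF this, of x]
      have "norm (inverse (w - z) *\<^sub>C (S_adj w x - S_adj z x)) \<le> onorm (?R w) * norm x + norm (cadj (D (cnj z)) x)"
        using norm_triangle_sub[of "inverse (w - z) *\<^sub>C (S_adj w x - S_adj z x)" "cadj (D (cnj z)) x"] by simp
      then have "cmod (w - z) * norm (inverse (w - z) *\<^sub>C (S_adj w x - S_adj z x)) \<le> cmod (w - z) * (onorm (?R w) * norm x + norm (cadj (D (cnj z)) x))"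
        by (rule mult_left_mono) simp
      then show ?case
        using elim(2) by (simp add: norm_scaleC norm_inverse mult.assoc[symmetric])
    qed
    show "((\<lambda>w. cmod (w - z) * (onorm (?R w) * norm x + norm (cadj (D (cnj z)) x))) \<longlongrightarrow> 0) (at z)"
      by (rule tendsto_eq_intros S_adj_deriv[OF z] refl | simp)+
  qed
  then show ?thesis by (simp add: isCont_def LIM_zero_iff)
qed

text \<open>The vectors at which the adjoint semigroup is continuous form a closed subspace that contains
  the ranges of \<open>S_adj t\<close>, \<open>t > 0\<close>; these are dense because \<open>S\<close> is strongly continuous.\<close>

lemma S_adj_at_0: "((\<lambda>z. S_adj z x) \<longlongrightarrow> x) (at 0 within sector \<delta>)"
proof -
  let ?F = "at 0 within sector \<delta>"
  define V where "V = {x. ((\<lambda>z. S_adj z x) \<longlongrightarrow> x) ?F}"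
  have ev: "\<forall>\<^sub>F z in ?F. z \<in> sector \<delta>" by (simp add: eventually_at_filter)
  have lin: "linear (S_adj z)" if "z \<in> sector \<delta>" for z
    using bounded_clinear_S_adj[OF that] bounded_clinearD(1) bounded_linear.linear by blast
  have add: "x + y \<in> V" if "x \<in> V" "y \<in> V" for x y
  proof -
    have "((\<lambda>z. S_adj z x + S_adj z y) \<longlongrightarrow> x + y) ?F" using that by (intro tendsto_add) (auto simp: V_def)
    moreover have "\<forall>\<^sub>F z in ?F. S_adj z x + S_adj z y = S_adj z (x + y)"
      using ev by eventually_elim (simp add: linear_add[OF lin])
    ultimately show ?thesis unfolding V_def mem_Collect_eq by (rule Lim_transform_eventually)
  qed
  have scale: "c *\<^sub>C x \<in> V" if "x \<in> V" for c x
  proof -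
    have "((\<lambda>z. c *\<^sub>C S_adj z x) \<longlongrightarrow> c *\<^sub>C x) ?F"
      using that by (intro bounded_linear.tendsto[OF bounded_linear_scaleC_right]) (auto simp: V_def)
    moreover have "\<forall>\<^sub>F z in ?F. c *\<^sub>C S_adj z x = S_adj z (c *\<^sub>C x)"
      using ev by eventually_elim (simp add: bounded_clinearD(2)[OF bounded_clinear_S_adj])
    ultimately show ?thesis unfolding V_def mem_Collect_eq by (rule Lim_transform_eventually)
  qed
  have "closed V"
    unfolding closed_sequential_limits
  proof (intro allI impI, elim conjE)
    fix X x assume X: "\<forall>n. X n \<in> V" and lim: "X \<longlonglongrightarrow> x"
    show "x \<in> V"
      unfolding V_def mem_Collect_eq
    proof (rule tendstoI)
      fix e :: real assume e: "0 < e"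
      \<comment> \<open>Passing through \<open>X n\<close> costs the factor \<open>B\<close> for
        \<open>S_adj z\<close> applied to \<open>x - X n\<close> and \<open>1\<close> for each of
        the two other differences, hence \<open>B + 2\<close>.\<close>
      have B0: "0 < B + 2" using B(1) by simp
      obtain n where n: "dist (X n) x < e / (B + 2)"
        using metric_LIMSEQ_D[OF lim, of "e / (B + 2)"] e B0 by auto
      have "((\<lambda>z. S_adj z (X n)) \<longlongrightarrow> X n) ?F" using X by (simp add: V_def)
      then have "\<forall>\<^sub>F z in ?F. dist (S_adj z (X n)) (X n) < e / (B + 2)"
        using e B0 by (intro tendstoD) auto
      then show "\<forall>\<^sub>F z in ?F. dist (S_adj z x) x < e"
        using ev
      proof eventually_elim
        case (elim z)
        have "norm (S_adj z (X n) - S_adj z x) \<le> B * norm (X n - x)"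
          using norm_S_adj_le[OF elim(2), of "X n - x"] by (simp add: linear_diff[OF lin[OF elim(2)]])
        also have "\<dots> \<le> B * (e / (B + 2))" using n B(1) by (intro mult_left_mono) (auto simp: dist_norm)
        finally have "dist (S_adj z x) (S_adj z (X n)) \<le> B * (e / (B + 2))"
          by (simp add: dist_norm norm_minus_commute)
        then have "dist (S_adj z x) x < B * (e / (B + 2)) + e / (B + 2) + e / (B + 2)"
          using n elim(1) dist_triangle[of "S_adj z x" x "S_adj z (X n)"] dist_triangle[of "S_adj z (X n)" x "X n"]
          by linarith
        also have "\<dots> = (B + 2) * (e / (B + 2))" by (simp only: distrib_right mult_2 add.assoc)
        also have "\<dots> = e" using B0 by simp
        finally show ?case .
      qed
    qed
  qed
  moreover have "0 \<in> V"
  proof -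
    have "\<forall>\<^sub>F z in ?F. 0 = S_adj z 0" using ev by eventually_elim (simp add: linear_0[OF lin])
    then show ?thesis unfolding V_def mem_Collect_eq by (rule Lim_transform_eventually[OF tendsto_const])
  qed
  ultimately have V: "closed_csubspace V" by (simp add: closed_csubspace_def add scale)
  have range: "S_adj (complex_of_real t) x \<in> V" if t: "0 < t" for t x
  proof -
    have "((\<lambda>z. z + complex_of_real t) \<longlongrightarrow> complex_of_real t) ?F" by (auto intro!: tendsto_eq_intros)
    then have "((\<lambda>z. S_adj (z + complex_of_real t) x) \<longlongrightarrow> S_adj (complex_of_real t) x) ?F"
      by (rule isCont_tendsto_compose[OF isCont_S_adj[OF real_mem_sector[OF t]]])
    moreover have "\<forall>\<^sub>F z in ?F. S_adj (z + complex_of_real t) x = S_adj z (S_adj (complex_of_real t) x)"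
      using ev by eventually_elim (simp add: S_adj_add real_mem_sector t)
    ultimately show ?thesis unfolding V_def mem_Collect_eq by (rule Lim_transform_eventually)
  qed
  have "V = UNIV"
  proof (rule csubspace_eq_UNIV[OF V])
    fix y assume y: "\<And>x. x \<in> V \<Longrightarrow> cinner x y = 0"
    \<comment> \<open>Orthogonality to the range of \<open>S_adj\<close> at time \<open>t\<close>
      says that \<open>T t y\<close> pairs to zero with every \<open>x\<close>. Letting
      \<open>t\<close> tend to \<open>0\<close> gives \<open>y = 0\<close>.\<close>
    have "T t y = 0" if "0 < t" for t
    proof (rule cinner_eqI2)
      show "cinner x (T t y) = cinner x 0" for x
        using y[OF range[OF that, of x]] cinner_cadj_left[OF bounded_clinear_S[OF real_mem_sector[OF that]]]
        by (simp add: S_adj_def)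
    qed
    then have "\<forall>\<^sub>F t in at_right 0. T t y = 0" by (simp add: eventually_at_filter)
    then have "((\<lambda>t. T t y) \<longlongrightarrow> 0) (at_right 0)" by (rule tendsto_eventually)
    moreover have "((\<lambda>t. T t y) \<longlongrightarrow> T 0 y) (at_right 0)"
      by (rule tendsto_T) (auto simp: eventually_at_filter intro: tendsto_ident_at)
    ultimately show "y = 0" using tendsto_unique[of "at_right (0::real)"] by (auto simp: S_0)
  qed
  then show ?thesis by (auto simp: V_def)
qed

lemma analytic_semigroup_S_adj: "analytic_semigroup \<delta> S_adj"
proof
  have "S_adj 0 = id" unfolding S_adj_def by (rule ext, rule cadj_eqI) (simp add: S_0)
  moreover have "\<exists>E. bounded_clinear E \<and>
      ((\<lambda>w. onorm (\<lambda>x. inverse (w - z) *\<^sub>C (S_adj w x - S_adj z x) - E x)) \<longlongrightarrow> 0) (at z)"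
    if "z \<in> sector \<delta>" for z
    using S_adj_deriv[OF that] bounded_clinear_cadj[OF D(1)[OF cnj_mem_sector[OF that]]] by blast
  ultimately show "bdd_analytic_semigroup \<delta> S_adj"
    unfolding bdd_analytic_semigroup_def
    using bounded_clinear_S_adj S_adj_add norm_S_adj_le S_adj_at_0 by blast
qed (rule \<delta>_pos \<delta>_less)+

interpretation adj: analytic_semigroup \<delta> S_adj by (rule analytic_semigroup_S_adj)

lemma cinner_T_adj: "0 < t \<Longrightarrow> cinner (T t x) y = cinner x (adj.T t y)"
  by (simp add: S_adj_def cinner_cadj bounded_clinear_S real_mem_sector)

text \<open>\<open>adj.D\<close> comes from a choice of its own and is not defined as an adjoint, so
  the identity is obtained by pairing real difference quotients and comparing limits.\<close>

lemma cinner_D_adj: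
  assumes t: "0 < t"
  shows "cinner (D (complex_of_real t) x) y = cinner x (adj.D (complex_of_real t) y)"
proof -
  have ev: "\<forall>\<^sub>F r in at t. 0 < r"
    using t by (intro order_tendstoD(1)[OF tendsto_ident_at])
  have "((\<lambda>r. cinner ((1 / (r - t)) *\<^sub>R (T r x - T t x)) y) \<longlongrightarrow> cinner (D (complex_of_real t) x) y) (at t)"
    using T_has_vector_derivative[OF t, of x] by (intro tendsto_cinner) (auto simp: has_vector_derivative_iff_quotient)
  moreover have "\<forall>\<^sub>F r in at t. cinner ((1 / (r - t)) *\<^sub>R (T r x - T t x)) y = cinner x ((1 / (r - t)) *\<^sub>R (adj.T r y - adj.T t y))"
    using ev
  proof eventually_elim
    case (elim r)
    then show ?case using t by (simp add: cinner_scaleR_left cinner_scaleR_right cinner_diff_left cinner_diff_right cinner_T_adj)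
  qed
  ultimately have "((\<lambda>r. cinner x ((1 / (r - t)) *\<^sub>R (adj.T r y - adj.T t y))) \<longlongrightarrow> cinner (D (complex_of_real t) x) y) (at t)"
    by (rule Lim_transform_eventually)
  moreover have "((\<lambda>r. cinner x ((1 / (r - t)) *\<^sub>R (adj.T r y - adj.T t y))) \<longlongrightarrow> cinner x (adj.D (complex_of_real t) y)) (at t)"
    using adj.T_has_vector_derivative[OF t, of y] by (intro tendsto_cinner) (auto simp: has_vector_derivative_iff_quotient)
  ultimately show ?thesis by (rule tendsto_unique[OF at_neq_bot])
qed

text \<open>One inclusion passes to the limit in paired difference quotients. For the other,
  membership in \<open>adj\<close> yields the derivative of the adjoint orbit at times
  \<open>s > 0\<close>, and a mean value estimate recovers the quotient at \<open>0\<close>.\<close>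

lemma neg_generator_S_adj: "neg_generator S_adj = adj (neg_generator S)"
proof (intro subset_antisym subrelI)
  fix x y assume xy: "(x, y) \<in> neg_generator S_adj"
  show "(x, y) \<in> adj (neg_generator S)"
    unfolding adj_def
  proof clarsimp
    fix u v assume uv: "(u, v) \<in> neg_generator S"
    have "((\<lambda>t. cinner ((1 / t) *\<^sub>R (u - T t u)) x) \<longlongrightarrow> cinner v x) (at_right 0)"
      using uv by (intro tendsto_cinner) (auto simp: neg_generator_def)
    moreover have "\<forall>\<^sub>F t in at_right 0. cinner ((1 / t) *\<^sub>R (u - T t u)) x = cinner u ((1 / t) *\<^sub>R (x - adj.T t x))"
      unfolding eventually_at_filter
      by (intro always_eventually)
        (simp add: cinner_scaleR_left cinner_scaleR_right cinner_diff_left cinner_diff_right cinner_T_adj)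
    ultimately have "((\<lambda>t. cinner u ((1 / t) *\<^sub>R (x - adj.T t x))) \<longlongrightarrow> cinner v x) (at_right 0)"
      by (rule Lim_transform_eventually)
    moreover have "((\<lambda>t. cinner u ((1 / t) *\<^sub>R (x - adj.T t x))) \<longlongrightarrow> cinner u y) (at_right 0)"
      using xy by (intro tendsto_cinner) (auto simp: neg_generator_def)
    ultimately show "cinner v x = cinner u y" by (rule tendsto_unique[rotated]) simp
  qed
next
  fix x y assume xy: "(x, y) \<in> adj (neg_generator S)"
  \<comment> \<open>Test the definition of \<open>adj\<close> with \<open>T s u\<close>, which lies
    in the domain for every \<open>u\<close>.\<close>
  have D_eq: "adj.D (complex_of_real s) x = - adj.T s y" if s: "0 < s" for s
  proof (rule cinner_eqI2)
    fix u
    have "cinner (- D (complex_of_real s) u) x = cinner (T s u) y"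
      using xy T_mem_generator[OF s, of u] unfolding adj_def by auto
    then show "cinner u (adj.D (complex_of_real s) x) = cinner u (- adj.T s y)"
      by (simp add: cinner_minus_left cinner_minus_right cinner_D_adj[OF s] cinner_T_adj[OF s] minus_equation_iff)
  qed
  have lim: "((\<lambda>s. adj.T s y) \<longlongrightarrow> adj.T 0 y) (at_right 0)"
    by (rule adj.tendsto_T) (auto simp: eventually_at_filter intro: tendsto_ident_at)
  have "((\<lambda>t. (1 / t) *\<^sub>R (x - adj.T t x)) \<longlongrightarrow> y) (at_right 0)"
  proof (rule tendstoI)
    fix e :: real assume e: "0 < e"
    have "\<forall>\<^sub>F s in at_right 0. dist (adj.T s y) y < e / 2"
      using tendstoD[OF lim, of "e / 2"] e by (simp add: adj.S_0)
    then obtain d where d: "0 < d" "\<And>s. 0 < s \<Longrightarrow> s < d \<Longrightarrow> dist (adj.T s y) y < e / 2"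
      by (auto simp: eventually_at_right_field)
    have "dist ((1 / t) *\<^sub>R (x - adj.T t x)) y < e" if t: "0 < t" "t < d" for t
    proof -
      \<comment> \<open>Its derivative \<open>y - adj.T s y\<close> has norm at most
        \<open>e / 2\<close> on \<open>(0, t)\<close>. The mean value inequality asks for continuity
        at the endpoint \<open>0\<close> but for no derivative there, where differentiability of the
        orbit is the very claim.\<close>
      let ?\<psi> = "\<lambda>s. adj.T s x + s *\<^sub>R y"
      have "norm (?\<psi> t - ?\<psi> 0) \<le> e / 2 * t - e / 2 * 0"
      proof (rule differentiable_bound_general[OF t(1)])
        show "continuous_on {0..t} ?\<psi>"
          by (intro continuous_intros continuous_on_subset[OF adj.continuous_on_T]) auto
        show "(?\<psi> has_vector_derivative (y - adj.T s y)) (at s)" if "0 < s" "s < t" for s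
          using adj.T_has_vector_derivative[OF that(1), of x] D_eq[OF that(1)]
          by (auto intro!: derivative_eq_intros)
        show "((\<lambda>s. e / 2 * s) has_vector_derivative e / 2) (at s)" for s
          by (auto intro!: derivative_eq_intros)
        show "norm (y - adj.T s y) \<le> e / 2" if "0 < s" "s < t" for s
          using d(2)[of s] that t by (simp add: dist_norm norm_minus_commute)
      qed (auto intro!: continuous_intros)
      then have "norm (adj.T t x + t *\<^sub>R y - x) \<le> e / 2 * t" by (simp add: adj.S_0)
      moreover have "(1 / t) *\<^sub>R (x - adj.T t x) - y = (- 1 / t) *\<^sub>R (adj.T t x + t *\<^sub>R y - x)"
        using t by (simp add: algebra_simps)
      then have "norm ((1 / t) *\<^sub>R (x - adj.T t x) - y) = norm (adj.T t x + t *\<^sub>R y - x) / t"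
        using t by simp
      ultimately have "norm ((1 / t) *\<^sub>R (x - adj.T t x) - y) \<le> e / 2"
        using t by (simp only: pos_divide_le_eq)
      then show ?thesis using e by (simp add: dist_norm)
    qed
    then show "\<forall>\<^sub>F t in at_right 0. dist ((1 / t) *\<^sub>R (x - adj.T t x)) y < e"
      using d(1) by (auto simp: eventually_at_right_field)
  qed
  then show "(x, y) \<in> neg_generator S_adj" by (simp add: neg_generator_def)
qed

lemma cinner_A_exp:
  assumes "0 < t"
  shows "cinner (A_exp (neg_generator S) t x) y = cinner x (A_exp (adj (neg_generator S)) t y)"
  using cinner_D_adj[OF assms] adj.A_exp_eq[OF assms]
  by (simp add: A_exp_eq[OF assms] neg_generator_S_adj cinner_minus_left cinner_minus_right)

lemma tendsto_A_exp_adj: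
  assumes "(u \<longlongrightarrow> t) F" "0 < t"
  shows "((\<lambda>i. A_exp (adj (neg_generator S)) (u i) x) \<longlongrightarrow> A_exp (adj (neg_generator S)) t x) F"
proof -
  have "\<forall>\<^sub>F i in F. - adj.D (complex_of_real (u i)) x = A_exp (adj (neg_generator S)) (u i) x"
    using order_tendstoD(1)[OF assms]
    by eventually_elim (simp add: adj.A_exp_eq flip: neg_generator_S_adj)
  from Lim_transform_eventually[OF tendsto_minus[OF adj.tendsto_D[OF assms(1) tendsto_const assms(2)]] this]
  show ?thesis by (simp add: adj.A_exp_eq assms flip: neg_generator_S_adj)
qed

lemma tendsto_A_exp:
  assumes "(u \<longlongrightarrow> t) F" "(v \<longlongrightarrow> x) F" "0 < t"
  shows "((\<lambda>i. A_exp (neg_generator S) (u i) (v i)) \<longlongrightarrow> A_exp (neg_generator S) t x) F"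
proof -
  have "\<forall>\<^sub>F i in F. - D (complex_of_real (u i)) (v i) = A_exp (neg_generator S) (u i) (v i)"
    using order_tendstoD(1)[OF assms(1,3)] by eventually_elim (simp add: A_exp_eq)
  from Lim_transform_eventually[OF tendsto_minus[OF tendsto_D[OF assms]] this]
  show ?thesis by (simp add: A_exp_eq assms)
qed

end

section \<open>Square integrable functions on the half line\<close>

lemma nn_integral_lebesgue_on_subset:
  assumes "A \<subseteq> S" "A \<in> sets lebesgue" "S \<in> sets lebesgue"
  shows "(\<integral>\<^sup>+x. f x \<partial>lebesgue_on A) = (\<integral>\<^sup>+x. f x * indicator A x \<partial>lebesgue_on S)"
proof -
  have "(\<integral>\<^sup>+x. f x \<partial>lebesgue_on A) = (\<integral>\<^sup>+x. f x * indicator A x \<partial>lebesgue)"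
    using assms by (intro nn_integral_restrict_space) simp
  also have "\<dots> = (\<integral>\<^sup>+x. f x * indicator A x * indicator S x \<partial>lebesgue)"
    using assms(1) by (intro nn_integral_cong) (auto simp: indicator_def)
  also have "\<dots> = (\<integral>\<^sup>+x. f x * indicator A x \<partial>lebesgue_on S)"
    using assms by (intro nn_integral_restrict_space[symmetric]) simp
  finally show ?thesis .
qed

lemma nn_integral_lebesgue_on_mono:
  assumes "A \<subseteq> S" "A \<in> sets lebesgue" "S \<in> sets lebesgue"
  shows "(\<integral>\<^sup>+x. f x \<partial>lebesgue_on A) \<le> (\<integral>\<^sup>+x. f x \<partial>lebesgue_on S)"
  unfolding nn_integral_lebesgue_on_subset[OF assms]
  by (intro nn_integral_mono) (auto simp: indicator_def)

lemma strongly_measurable_cong: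
  assumes "\<And>x. x \<in> space M \<Longrightarrow> f x = g x"
  shows "strongly_measurable M f \<longleftrightarrow> strongly_measurable M g"
proof -
  have "(AE x in M. (\<lambda>i. s i x) \<longlonglongrightarrow> f x) \<longleftrightarrow> (AE x in M. (\<lambda>i::nat. s i x) \<longlonglongrightarrow> g x)" for s
    by (rule AE_cong) (simp add: assms)
  then show ?thesis by (simp add: strongly_measurable_def)
qed

lemma strongly_measurable_ident: "strongly_measurable (lebesgue_on S) (\<lambda>x::real. x)"
  by (intro strongly_measurable_borel measurable_restrict_space1 measurable_completion) simp

lemma L2w_cong:
  assumes "\<And>t. 0 < t \<Longrightarrow> f t = g t"
  shows "f \<in> L2w \<longleftrightarrow> g \<in> L2w" "L2w_sq f = L2w_sq g"
proof -
  show *: "L2w_sq f = L2w_sq g" unfolding L2w_sq_def by (rule nn_integral_cong) (simp add: assms)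
  have "strongly_measurable (lebesgue_on {0<..}) f = strongly_measurable (lebesgue_on {0<..}) g"
    by (rule strongly_measurable_cong) (simp add: assms)
  with * show "f \<in> L2w \<longleftrightarrow> g \<in> L2w" by (simp add: L2w_def)
qed

lemma L2wD: "f \<in> L2w \<Longrightarrow> strongly_measurable (lebesgue_on {0<..}) f" "f \<in> L2w \<Longrightarrow> L2w_sq f < \<infinity>"
  by (simp_all add: L2w_def)

lemma borel_measurable_norm_sq_div:
  fixes f :: "real \<Rightarrow> 'h::complex_hilbert"
  assumes f: "strongly_measurable (lebesgue_on {0<..}) f"
  shows "(\<lambda>t. (norm (f t))\<^sup>2 / t) \<in> borel_measurable (lebesgue_on {0<..})"
proof -
  interpret complete_measure "lebesgue_on {0::real<..}" by (rule complete_measure_lebesgue_on) simp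
  show ?thesis
    by (intro borel_measurable_divide borel_measurable_power borel_measurable_norm_strongly_measurable
        borel_measurable_strongly_measurable strongly_measurable_ident f)
qed

lemma norm_add_sq_le: "(norm (x + y :: 'a::real_normed_vector))\<^sup>2 \<le> 2 * (norm x)\<^sup>2 + 2 * (norm y)\<^sup>2"
proof -
  have "(norm (x + y))\<^sup>2 \<le> (norm x + norm y)\<^sup>2" by (intro power_mono norm_triangle_ineq) simp
  also have "\<dots> \<le> 2 * (norm x)\<^sup>2 + 2 * (norm y)\<^sup>2"
    using sum_squares_bound[of "norm x" "norm y"] by (simp add: power2_sum)
  finally show ?thesis .
qed

lemma L2w_zero: "(\<lambda>t. 0) \<in> L2w"
  by (simp add: L2w_def L2w_sq_def strongly_measurable_simple)

lemma L2w_add: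
  assumes f: "f \<in> L2w" and g: "g \<in> L2w"
  shows "(\<lambda>t. f t + g t) \<in> L2w"
proof -
  note [measurable] = borel_measurable_norm_sq_div[OF L2wD(1)[OF f]] borel_measurable_norm_sq_div[OF L2wD(1)[OF g]]
  have "L2w_sq (\<lambda>t. f t + g t) \<le> (\<integral>\<^sup>+t. 2 * ennreal ((norm (f t))\<^sup>2 / t) + 2 * ennreal ((norm (g t))\<^sup>2 / t) \<partial>lebesgue_on {0<..})"
    unfolding L2w_sq_def
  proof (rule nn_integral_mono)
    fix t :: real assume "t \<in> space (lebesgue_on {0<..})"
    then have t: "0 < t" by simp
    have "(norm (f t + g t))\<^sup>2 / t \<le> 2 * ((norm (f t))\<^sup>2 / t) + 2 * ((norm (g t))\<^sup>2 / t)"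
      using divide_right_mono[OF norm_add_sq_le[of "f t" "g t"], of t] t by (simp add: add_divide_distrib)
    then have "ennreal ((norm (f t + g t))\<^sup>2 / t) \<le> ennreal (2 * ((norm (f t))\<^sup>2 / t) + 2 * ((norm (g t))\<^sup>2 / t))"
      by (rule ennreal_leI)
    also have "\<dots> = 2 * ennreal ((norm (f t))\<^sup>2 / t) + 2 * ennreal ((norm (g t))\<^sup>2 / t)"
      using t by (subst ennreal_plus) (auto simp: ennreal_mult simp del: times_divide_eq_right)
    finally show "ennreal ((norm (f t + g t))\<^sup>2 / t) \<le> \<dots>" .
  qed
  also have "\<dots> = 2 * L2w_sq f + 2 * L2w_sq g"
    unfolding L2w_sq_def by (simp add: nn_integral_add nn_integral_cmult)
  also have "\<dots> < \<infinity>" using L2wD(2)[OF f] L2wD(2)[OF g] by (simp add: ennreal_mult_less_top)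
  finally show ?thesis
    using strongly_measurable_add[OF L2wD(1)[OF f] L2wD(1)[OF g]] by (simp add: L2w_def)
qed

lemma L2w_scaleC:
  assumes f: "f \<in> L2w" shows "(\<lambda>t. c *\<^sub>C f t) \<in> L2w"
proof -
  note [measurable] = borel_measurable_norm_sq_div[OF L2wD(1)[OF f]]
  have "L2w_sq (\<lambda>t. c *\<^sub>C f t) = (\<integral>\<^sup>+t. ennreal ((cmod c)\<^sup>2) * ennreal ((norm (f t))\<^sup>2 / t) \<partial>lebesgue_on {0<..})"
    unfolding L2w_sq_def by (rule nn_integral_cong) (simp add: norm_scaleC power_mult_distrib flip: ennreal_mult')
  also have "\<dots> = ennreal ((cmod c)\<^sup>2) * L2w_sq f" unfolding L2w_sq_def by (rule nn_integral_cmult) measurable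
  also have "\<dots> < \<infinity>" using L2wD(2)[OF f] by (simp add: ennreal_mult_less_top)
  finally show ?thesis
    using strongly_measurable_compose[OF L2wD(1)[OF f], of "\<lambda>x. c *\<^sub>C x"]
    by (simp add: L2w_def bounded_linear.tendsto[OF bounded_linear_scaleC_right])
qed

text \<open>On \<open>[a, b]\<close> use \<open>norm (f t) \<le> 1 + (norm (f t))\<^sup>2\<close>
  and \<open>1 \<le> b / t\<close>; the weighted norm and the length of the interval are
  finite.\<close>

lemma nn_integral_norm_Icc_finite:
  fixes f :: "real \<Rightarrow> 'h::complex_hilbert"
  assumes f: "f \<in> L2w" and a: "0 < a"
  shows "(\<integral>\<^sup>+t. ennreal (norm (f t)) \<partial>lebesgue_on {a..b}) < \<infinity>"
proof -
  have sub: "{a..b} \<subseteq> {0<..}" using a by auto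
  have [measurable]: "(\<lambda>t. (norm (f t))\<^sup>2 / t) \<in> borel_measurable (lebesgue_on {a..b})"
    using measurable_restrict_mono[OF borel_measurable_norm_sq_div[OF L2wD(1)[OF f]] sub] .
  have "(\<integral>\<^sup>+t. ennreal (norm (f t)) \<partial>lebesgue_on {a..b})
    \<le> (\<integral>\<^sup>+t. 1 + ennreal b * ennreal ((norm (f t))\<^sup>2 / t) \<partial>lebesgue_on {a..b})"
  proof (rule nn_integral_mono)
    fix t assume "t \<in> space (lebesgue_on {a..b})"
    then have t: "0 < t" "t \<le> b" using a by auto
    have "norm (f t) \<le> 1 + (norm (f t))\<^sup>2"
    proof (cases "norm (f t) \<le> 1")
      case False then show ?thesis using power_increasing[of 1 2 "norm (f t)"] by simp
    qed (simp add: add_increasing2)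
    also have "\<dots> \<le> 1 + b * ((norm (f t))\<^sup>2 / t)"
      using mult_right_mono[OF t(2), of "(norm (f t))\<^sup>2"] t by (simp add: field_simps)
    finally have "ennreal (norm (f t)) \<le> ennreal (1 + b * ((norm (f t))\<^sup>2 / t))" by (rule ennreal_leI)
    also have "\<dots> = 1 + ennreal b * ennreal ((norm (f t))\<^sup>2 / t)"
      using t by (subst ennreal_plus) (auto simp: ennreal_mult simp del: times_divide_eq_right)
    finally show "ennreal (norm (f t)) \<le> \<dots>" .
  qed
  also have "\<dots> = emeasure lebesgue {a..b} + ennreal b * (\<integral>\<^sup>+t. ennreal ((norm (f t))\<^sup>2 / t) \<partial>lebesgue_on {a..b})"
    by (simp add: nn_integral_add nn_integral_cmult emeasure_restrict_space)
  also have "\<dots> \<le> emeasure lebesgue {a..b} + ennreal b * L2w_sq f"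
    unfolding L2w_sq_def by (intro add_left_mono mult_left_mono nn_integral_lebesgue_on_mono sub) auto
  also have "\<dots> < \<infinity>"
    using L2wD(2)[OF f] by (cases "a \<le> b") (auto simp: ennreal_mult_less_top)
  finally show ?thesis .
qed

text \<open>The mean value over \<open>[\<tau>, 2\<tau>]\<close> ignores \<open>u\<close> in the limit because
  \<open>\<parallel>u\<parallel> \<le> e/4 + \<parallel>u\<parallel>\<^sup>2/e\<close> and \<open>dt/\<tau> \<le> 2 dt/t\<close> there.\<close>

context
  fixes u v w :: "real \<Rightarrow> 'h::complex_hilbert" and M :: real and b :: 'h
  assumes u: "u \<in> L2w"
    and v: "strongly_measurable (lebesgue_on {0<..}) v"
    and v_le: "\<And>t. 0 < t \<Longrightarrow> norm (v t) \<le> M"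
    and v_lim: "(v \<longlongrightarrow> b) (at_right 0)"
    and w: "\<And>t. 0 < t \<Longrightarrow> w t = u t + v t"
begin

lemma strongly_measurable_perturbed: "strongly_measurable (lebesgue_on {0<..}) w"
  using strongly_measurable_add[OF L2wD(1)[OF u] v] strongly_measurable_cong[of "lebesgue_on {0<..}" w "\<lambda>t. u t + v t"] w
  by simp

text \<open>In the application \<open>u\<close> is the image of \<open>f\<close> under the bounded
  extension and \<open>v\<close> the orbit of the weak integral. On \<open>K\<close> the factor
  \<open>c / t\<close> is at least \<open>1\<close>, which trades \<open>dt\<close> for
  \<open>dt / t\<close>; both factors \<open>2\<close> come from squaring a sum.\<close>

lemma nn_integral_perturbed_le:
  assumes K: "K \<in> sets lebesgue" "K \<subseteq> {0<..c}" and c: "0 \<le> c"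
  shows "(\<integral>\<^sup>+t. ennreal ((norm (w t))\<^sup>2) \<partial>lebesgue_on K) \<le> ennreal (2 * c) * L2w_sq u + ennreal (2 * M\<^sup>2) * emeasure lebesgue K"
proof -
  have sub: "K \<subseteq> {0<..}" using K by auto
  have [measurable]: "(\<lambda>t. (norm (u t))\<^sup>2 / t) \<in> borel_measurable (lebesgue_on K)"
    using measurable_restrict_mono[OF borel_measurable_norm_sq_div[OF L2wD(1)[OF u]] sub] .
  have "(\<integral>\<^sup>+t. ennreal ((norm (w t))\<^sup>2) \<partial>lebesgue_on K)
    \<le> (\<integral>\<^sup>+t. ennreal (2 * c) * ennreal ((norm (u t))\<^sup>2 / t) + ennreal (2 * M\<^sup>2) \<partial>lebesgue_on K)"
  proof (rule nn_integral_mono)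
    fix t assume "t \<in> space (lebesgue_on K)"
    then have t: "0 < t" "t \<le> c" using K by auto
    have "(norm (w t))\<^sup>2 \<le> 2 * (norm (u t))\<^sup>2 + 2 * (norm (v t))\<^sup>2"
      using norm_add_sq_le[of "u t" "v t"] w t by simp
    also have "\<dots> \<le> 2 * c * ((norm (u t))\<^sup>2 / t) + 2 * M\<^sup>2"
    proof -
      have "(norm (u t))\<^sup>2 \<le> c * ((norm (u t))\<^sup>2 / t)"
        using mult_right_mono[OF t(2), of "(norm (u t))\<^sup>2"] t by (simp add: field_simps)
      moreover have "(norm (v t))\<^sup>2 \<le> M\<^sup>2" using v_le[OF t(1)] by (intro power_mono) auto
      ultimately show ?thesis by simp
    qed
    finally have "ennreal ((norm (w t))\<^sup>2) \<le> ennreal (2 * c * ((norm (u t))\<^sup>2 / t) + 2 * M\<^sup>2)" by (rule ennreal_leI)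
    also have "\<dots> = ennreal (2 * c) * ennreal ((norm (u t))\<^sup>2 / t) + ennreal (2 * M\<^sup>2)"
      using t by (subst ennreal_plus) (auto simp flip: ennreal_mult)
    finally show "ennreal ((norm (w t))\<^sup>2) \<le> \<dots>" .
  qed
  also have "\<dots> = ennreal (2 * c) * (\<integral>\<^sup>+t. ennreal ((norm (u t))\<^sup>2 / t) \<partial>lebesgue_on K) + ennreal (2 * M\<^sup>2) * emeasure lebesgue K"
    using K by (subst nn_integral_add) (auto simp: nn_integral_cmult emeasure_restrict_space)
  also have "\<dots> \<le> ennreal (2 * c) * L2w_sq u + ennreal (2 * M\<^sup>2) * emeasure lebesgue K"
    unfolding L2w_sq_def by (intro add_right_mono mult_left_mono nn_integral_lebesgue_on_mono sub K) auto
  finally show ?thesis .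
qed

lemma perturbed_L2loc: "w \<in> L2loc"
  unfolding L2loc_def mem_Collect_eq
proof (intro conjI allI impI strongly_measurable_perturbed)
  fix K :: "real set" assume K: "compact K" "K \<subseteq> {0<..}"
  obtain c where c: "0 \<le> c" "K \<subseteq> {0<..c}"
  proof -
    obtain c where "\<And>x. x \<in> K \<Longrightarrow> norm x \<le> c" using compact_imp_bounded[OF K(1)] by (auto simp: bounded_iff)
    then have "K \<subseteq> {0<..max 0 c}" using K(2) by (fastforce simp: max_def)
    then show thesis by (intro that[of "max 0 c"]) auto
  qed
  have "(\<integral>\<^sup>+t. ennreal ((norm (w t))\<^sup>2) \<partial>lebesgue_on K) \<le> ennreal (2 * c) * L2w_sq u + ennreal (2 * M\<^sup>2) * emeasure lebesgue K"
    using K c by (intro nn_integral_perturbed_le) (auto intro: lmeasurable_compact fmeasurableD)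
  also have "\<dots> < \<infinity>"
    using L2wD(2)[OF u] fmeasurableD2[OF lmeasurable_compact[OF K(1)]] by (auto simp: ennreal_mult_less_top less_top)
  finally show "(\<integral>\<^sup>+t. ennreal ((norm (w t))\<^sup>2) \<partial>lebesgue_on K) < \<infinity>" .
qed

text \<open>The case \<open>c = 2 * \<tau>\<close>: the factor \<open>2 * c\<close> divided by
  \<open>\<tau>\<close> gives \<open>4\<close>, and the length of the interval cancels.\<close>

lemma perturbed_mean_square_le:
  assumes \<tau>: "0 < \<tau>"
  shows "ennreal (1 / \<tau>) * (\<integral>\<^sup>+t. ennreal ((norm (w t))\<^sup>2) \<partial>lebesgue_on {\<tau>..2 * \<tau>}) \<le> 4 * L2w_sq u + ennreal (2 * M\<^sup>2)"
proof -
  have "ennreal (1 / \<tau>) * (\<integral>\<^sup>+t. ennreal ((norm (w t))\<^sup>2) \<partial>lebesgue_on {\<tau>..2 * \<tau>})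
    \<le> ennreal (1 / \<tau>) * (ennreal (2 * (2 * \<tau>)) * L2w_sq u + ennreal (2 * M\<^sup>2) * emeasure lebesgue {\<tau>..2 * \<tau>})"
    using \<tau> by (intro mult_left_mono nn_integral_perturbed_le) auto
  also have "\<dots> = (ennreal (1 / \<tau>) * ennreal (4 * \<tau>)) * L2w_sq u + ennreal (2 * M\<^sup>2) * (ennreal (1 / \<tau>) * ennreal \<tau>)"
    using \<tau> by (simp add: distrib_left ac_simps)
  also have "\<dots> = 4 * L2w_sq u + ennreal (2 * M\<^sup>2)"
    using \<tau> by (simp flip: ennreal_mult')
  finally show ?thesis .
qed

lemma perturbed_dyadic_mean: "(dyadic_mean w \<longlongrightarrow> b) (at_right 0)"
proof (rule tendstoI)
  fix e :: real assume e: "0 < e"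
  define \<phi> where "\<phi> t = ennreal ((norm (u t))\<^sup>2 / t)" for t
  have \<phi> [measurable]: "\<phi> \<in> borel_measurable (lebesgue_on {0<..})"
    unfolding \<phi>_def[abs_def] by (intro measurable_compose[OF borel_measurable_norm_sq_div[OF L2wD(1)[OF u]]]) simp
  have "(\<integral>\<^sup>+t. \<phi> t \<partial>lebesgue_on {0<..}) < \<infinity>" using L2wD(2)[OF u] by (simp add: \<phi>_def L2w_sq_def)
  \<comment> \<open>The threshold \<open>e\<^sup>2 / 8\<close> times \<open>2 * \<tau> / e\<close>
    contributes \<open>e * \<tau> / 4\<close>. With \<open>e / 2\<close> from the pointwise terms
    the mean deviates by at most \<open>3 / 4 * e\<close>.\<close>
  then obtain n where n: "(\<integral>\<^sup>+x. \<phi> x * indicator (- {1 / real (Suc n)..real (Suc n)}) x \<partial>lebesgue_on {0<..}) < ennreal (e\<^sup>2 / 8)"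
    using e nn_integral_tail[OF \<phi>, of "ennreal (e\<^sup>2 / 8)"] by (auto simp: ennreal_zero_less_divide)
  have "\<forall>\<^sub>F t in at_right 0. dist (v t) b < e / 4" using tendstoD[OF v_lim, of "e / 4"] e by simp
  then obtain d where d: "0 < d" "\<And>t. 0 < t \<Longrightarrow> t < d \<Longrightarrow> dist (v t) b < e / 4"
    by (auto simp: eventually_at_right_field)
  \<comment> \<open>The bound \<open>d / 2\<close> keeps \<open>v\<close> near \<open>b\<close> on
    all of \<open>[\<tau>, 2\<tau>]\<close>; the other bound places this interval in the tail
    selected by \<open>n\<close>.\<close>
  have main: "dist (dyadic_mean w \<tau>) b < e" if \<tau>: "0 < \<tau>" "\<tau> < d / 2" "\<tau> < 1 / real (Suc n) / 2" for \<tau>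
  proof -
    let ?I = "{\<tau>..2 * \<tau>}"
    have sub: "?I \<subseteq> {0<..}" using \<tau> by auto
    have meas_I: "?I \<in> sets lebesgue" by simp
    interpret complete_measure "lebesgue_on ?I" by (rule complete_measure_lebesgue_on) simp
    have \<phi>I [measurable]: "\<phi> \<in> borel_measurable (lebesgue_on ?I)" using measurable_restrict_mono[OF \<phi> sub] .
    have wI: "strongly_measurable (lebesgue_on ?I) w"
      by (rule strongly_measurable_restrict[OF strongly_measurable_perturbed]) (use sub in auto)
    have small: "(\<integral>\<^sup>+t. \<phi> t \<partial>lebesgue_on ?I) \<le> ennreal (e\<^sup>2 / 8)"
    proof -
      have "(\<integral>\<^sup>+t. \<phi> t \<partial>lebesgue_on ?I) = (\<integral>\<^sup>+t. \<phi> t * indicator ?I t \<partial>lebesgue_on {0<..})"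
        by (rule nn_integral_lebesgue_on_subset[OF sub]) auto
      also have "\<dots> \<le> (\<integral>\<^sup>+x. \<phi> x * indicator (- {1 / real (Suc n)..real (Suc n)}) x \<partial>lebesgue_on {0<..})"
      proof (rule nn_integral_mono)
        fix t
        have "x < y / 2 \<Longrightarrow> 2 * x < y" for x y :: real by linarith
        from this[OF \<tau>(3)] have "2 * \<tau> < 1 / real (Suc n)" .
        then have "t \<notin> {1 / real (Suc n)..real (Suc n)}" if "t \<in> ?I" using that by (auto simp del: of_nat_Suc)
        then show "\<phi> t * indicator ?I t \<le> \<phi> t * indicator (- {1 / real (Suc n)..real (Suc n)}) t"
          by (intro mult_left_mono) (auto simp: indicator_def simp del: of_nat_Suc atLeastAtMost_iff)
      qed
      finally show ?thesis using n by simp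
    qed
    have wb: "(\<integral>\<^sup>+t. ennreal (norm (w t - b)) \<partial>lebesgue_on ?I) \<le> ennreal (3 / 4 * e * \<tau>)"
    proof -
      have "(\<integral>\<^sup>+t. ennreal (norm (w t - b)) \<partial>lebesgue_on ?I) \<le> (\<integral>\<^sup>+t. ennreal (e / 2) + ennreal (2 * \<tau> / e) * \<phi> t \<partial>lebesgue_on ?I)"
      proof (rule nn_integral_mono)
        fix t assume "t \<in> space (lebesgue_on ?I)"
        then have t: "0 < t" "t \<le> 2 * \<tau>" using \<tau> by auto
        have "norm (w t - b) \<le> norm (u t) + norm (v t - b)"
          using norm_triangle_ineq[of "u t" "v t - b"] w[OF t(1)] by (simp add: algebra_simps)
        moreover have "norm (v t - b) < e / 4" using d(2)[of t] t \<tau> by (simp add: dist_norm)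
        moreover have "norm (u t) \<le> e / 4 + (norm (u t))\<^sup>2 / e"
        proof -
          have "0 \<le> (norm (u t) - e / 2)\<^sup>2 / e" using e by simp
          then show ?thesis using e by (simp add: power2_diff field_simps power2_eq_square)
        qed
        moreover have "(norm (u t))\<^sup>2 / e \<le> 2 * \<tau> / e * ((norm (u t))\<^sup>2 / t)"
          using mult_right_mono[OF t(2), of "(norm (u t))\<^sup>2"] t e by (simp add: field_simps)
        ultimately have "norm (w t - b) \<le> e / 2 + 2 * \<tau> / e * ((norm (u t))\<^sup>2 / t)" by linarith
        then have "ennreal (norm (w t - b)) \<le> ennreal (e / 2 + 2 * \<tau> / e * ((norm (u t))\<^sup>2 / t))" by (rule ennreal_leI)
        also have "\<dots> = ennreal (e / 2) + ennreal (2 * \<tau> / e) * \<phi> t"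
          using e \<tau> t unfolding \<phi>_def by (subst ennreal_plus) (auto simp flip: ennreal_mult)
        finally show "ennreal (norm (w t - b)) \<le> \<dots>" .
      qed
      also have "\<dots> = ennreal (e / 2) * ennreal \<tau> + ennreal (2 * \<tau> / e) * (\<integral>\<^sup>+t. \<phi> t \<partial>lebesgue_on ?I)"
        using \<tau> by (simp add: nn_integral_add nn_integral_cmult emeasure_restrict_space)
      also have "\<dots> \<le> ennreal (e / 2) * ennreal \<tau> + ennreal (2 * \<tau> / e) * ennreal (e\<^sup>2 / 8)"
        by (intro add_left_mono mult_left_mono small) simp
      also have "\<dots> = ennreal (3 / 4 * e * \<tau>)"
        using e \<tau> by (simp add: power2_eq_square flip: ennreal_mult ennreal_plus)
      finally show ?thesis .
    qed
    have [measurable]: "(\<lambda>t. norm (w t - b)) \<in> borel_measurable (lebesgue_on ?I)"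
      by (rule borel_measurable_norm_strongly_measurable,
          rule strongly_measurable_diff[OF wI strongly_measurable_simple[OF simple_function_const]])
    have wfin: "(\<integral>\<^sup>+t. ennreal (norm (w t)) \<partial>lebesgue_on ?I) < \<infinity>"
    proof -
      have "(\<integral>\<^sup>+t. ennreal (norm (w t)) \<partial>lebesgue_on ?I) \<le> (\<integral>\<^sup>+t. ennreal (norm (w t - b)) + ennreal (norm b) \<partial>lebesgue_on ?I)"
      proof (rule nn_integral_mono)
        fix t
        show "ennreal (norm (w t)) \<le> ennreal (norm (w t - b)) + ennreal (norm b)"
          using ennreal_leI[OF norm_triangle_ineq[of "w t - b" b]] by simp
      qed
      also have "\<dots> = (\<integral>\<^sup>+t. ennreal (norm (w t - b)) \<partial>lebesgue_on ?I) + ennreal (norm b) * ennreal \<tau>"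
        using \<tau> by (subst nn_integral_add) (auto simp: emeasure_restrict_space)
      also have "\<dots> < \<infinity>" using wb by (auto simp: ennreal_mult_less_top intro: order.strict_trans1)
      finally show ?thesis .
    qed
    \<comment> \<open>The comparison is made after pairing with \<open>h\<close>: the constant
      \<open>b\<close> is subtracted inside the scalar integral, where it contributes
      \<open>\<tau> *\<^sub>R cinner b h\<close>.\<close>
    have "norm (dyadic_mean w \<tau> - b) \<le> 3 / 4 * e"
    proof (rule norm_le_cinnerI)
      fix h
      define I where "I = strong_integral ?I w"
      have "has_bochner_integral (lebesgue_on ?I) (\<lambda>t. cinner (w t) h) (cinner I h)"
        unfolding I_def by (rule strong_integral_cinner[OF meas_I wI wfin])
      moreover have "has_bochner_integral (lebesgue_on ?I) (\<lambda>t. cinner b h) (\<tau> *\<^sub>R cinner b h)"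
      proof -
        have "has_bochner_integral (lebesgue_on ?I) (\<lambda>t. indicator ?I t *\<^sub>R cinner b h) (measure (lebesgue_on ?I) ?I *\<^sub>R cinner b h)"
          using \<tau> by (intro has_bochner_integral_indicator) (auto simp: emeasure_restrict_space sets_restrict_space_iff)
        moreover have "measure (lebesgue_on ?I) ?I = \<tau>" using \<tau> by (simp add: measure_restrict_space)
        moreover have "has_bochner_integral (lebesgue_on ?I) (\<lambda>t. indicator ?I t *\<^sub>R cinner b h) x
            \<longleftrightarrow> has_bochner_integral (lebesgue_on ?I) (\<lambda>t. cinner b h) x" for x
          by (rule has_bochner_integral_cong) auto
        ultimately show ?thesis by simp
      qed
      ultimately have *: "has_bochner_integral (lebesgue_on ?I) (\<lambda>t. cinner (w t - b) h) (cinner I h - \<tau> *\<^sub>R cinner b h)"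
        unfolding cinner_diff_left by (rule has_bochner_integral_diff)
      have "ennreal (norm (cinner I h - \<tau> *\<^sub>R cinner b h)) \<le> (\<integral>\<^sup>+t. ennreal (norm (cinner (w t - b) h)) \<partial>lebesgue_on ?I)"
        using integral_norm_bound_ennreal[OF integrable.intros[OF *]] has_bochner_integral_integral_eq[OF *] by simp
      also have "\<dots> \<le> (\<integral>\<^sup>+t. ennreal (norm h) * ennreal (norm (w t - b)) \<partial>lebesgue_on ?I)"
      proof (rule nn_integral_mono)
        show "ennreal (norm (cinner (w t - b) h)) \<le> ennreal (norm h) * ennreal (norm (w t - b))" for t
          using cinner_Cauchy_Schwarz[of "w t - b" h] by (simp add: ennreal_leI mult.commute flip: ennreal_mult)
      qed
      also have "\<dots> = ennreal (norm h) * (\<integral>\<^sup>+t. ennreal (norm (w t - b)) \<partial>lebesgue_on ?I)"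
        by (rule nn_integral_cmult) measurable
      also have "\<dots> \<le> ennreal (norm h) * ennreal (3 / 4 * e * \<tau>)" by (intro mult_left_mono wb) simp
      also have "\<dots> = ennreal (norm h * (3 / 4 * e * \<tau>))" by (simp flip: ennreal_mult')
      finally have "norm (cinner I h - \<tau> *\<^sub>R cinner b h) \<le> norm h * (3 / 4 * e * \<tau>)"
        using e \<tau> by (subst (asm) ennreal_le_iff) auto
      moreover have "cinner I h - \<tau> *\<^sub>R cinner b h = \<tau> *\<^sub>R cinner (dyadic_mean w \<tau> - b) h"
        using \<tau> by (simp add: dyadic_mean_def I_def cinner_diff_left cinner_scaleR_left scaleR_conv_of_real right_diff_distrib)
      ultimately have "\<tau> * norm (cinner (dyadic_mean w \<tau> - b) h) \<le> \<tau> * (3 / 4 * e * norm h)"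
        using \<tau> by (simp add: ac_simps)
      then show "norm (cinner (dyadic_mean w \<tau> - b) h) \<le> 3 / 4 * e * norm h" using \<tau> by simp
    qed (use e in simp)
    then show ?thesis using e by (simp add: dist_norm)
  qed
  have "0 < min (d / 2) (1 / real (Suc n) / 2)" using d(1) by simp
  then show "\<forall>\<^sub>F \<tau> in at_right 0. dist (dyadic_mean w \<tau>) b < e"
    unfolding eventually_at_right_field by (intro exI[of _ "min (d / 2) (1 / real (Suc n) / 2)"]) (use main in \<open>simp del: of_nat_Suc\<close>)
qed

end

text \<open>The case \<open>v = 0\<close>, \<open>b = 0\<close>. It gives one half of the membership
  criterion: square integrability forces the means to vanish.\<close>

lemma L2w_dyadic_mean:
  assumes "w \<in> L2w" shows "(dyadic_mean w \<longlongrightarrow> 0) (at_right 0)"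
  by (rule perturbed_dyadic_mean[where u = w and v = "\<lambda>_. 0" and M = 0])
    (use assms in \<open>auto intro: strongly_measurable_simple\<close>)

section \<open>The weak integral\<close>

text \<open>Both ends move independently in the product filter; eventually
  \<open>{\<delta>..R}\<close> contains the interval given by
  \<open>nn_integral_tail\<close>.\<close>

lemma tendsto_prod_at_right_at_top_null:
  fixes \<phi> :: "real \<Rightarrow> ennreal"
  assumes \<phi>: "\<phi> \<in> borel_measurable (lebesgue_on {0<..})" and fin: "(\<integral>\<^sup>+x. \<phi> x \<partial>lebesgue_on {0<..}) < \<infinity>"
  shows "((\<lambda>(\<delta>, R). \<integral>\<^sup>+x. \<phi> x * indicator (- {\<delta>..R}) x \<partial>lebesgue_on {0<..}) \<longlongrightarrow> 0) (at_right 0 \<times>\<^sub>F at_top)"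
proof (rule order_tendstoI)
  fix e :: ennreal assume "0 < e"
  then obtain n where n: "(\<integral>\<^sup>+x. \<phi> x * indicator (- {1 / real (Suc n)..real (Suc n)}) x \<partial>lebesgue_on {0<..}) < e"
    using nn_integral_tail[OF \<phi> fin] by metis
  have "\<forall>\<^sub>F \<delta> in at_right 0. \<delta> \<le> 1 / real (Suc n)"
    unfolding eventually_at_right_field by (intro exI[of _ "1 / real (Suc n)"]) auto
  moreover have "\<forall>\<^sub>F R in at_top. real (Suc n) \<le> R" by (rule eventually_ge_at_top)
  ultimately have "\<forall>\<^sub>F p in at_right 0 \<times>\<^sub>F at_top. fst p \<le> 1 / real (Suc n) \<and> real (Suc n) \<le> snd p"
    by (intro eventually_prodI[THEN eventually_mono]) auto
  then show "\<forall>\<^sub>F p in at_right 0 \<times>\<^sub>F at_top. (case p of (\<delta>, R) \<Rightarrow> \<integral>\<^sup>+x. \<phi> x * indicator (- {\<delta>..R}) x \<partial>lebesgue_on {0<..}) < e"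
  proof (rule eventually_mono)
    fix p :: "real \<times> real" assume p: "fst p \<le> 1 / real (Suc n) \<and> real (Suc n) \<le> snd p"
    have "(\<integral>\<^sup>+x. \<phi> x * indicator (- {fst p..snd p}) x \<partial>lebesgue_on {0<..})
      \<le> (\<integral>\<^sup>+x. \<phi> x * indicator (- {1 / real (Suc n)..real (Suc n)}) x \<partial>lebesgue_on {0<..})"
      using p by (intro nn_integral_mono mult_left_mono) (auto simp: indicator_def)
    with n show "(case p of (\<delta>, R) \<Rightarrow> \<integral>\<^sup>+x. \<phi> x * indicator (- {\<delta>..R}) x \<partial>lebesgue_on {0<..}) < e"
      by (simp add: case_prod_beta)
  qed
qed simp

lemma ennreal_le_of_square_le:
  assumes "X\<^sup>2 \<le> ennreal (a\<^sup>2)" "0 \<le> a" shows "X \<le> ennreal a"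
proof (cases X)
  case (real r)
  then have "r\<^sup>2 \<le> a\<^sup>2" using assms by (simp add: ennreal_power)
  then show ?thesis using real assms power2_le_imp_le by (auto intro: ennreal_leI)
next
  case top
  then show ?thesis using assms by (simp add: power2_eq_square ennreal_top_mult top_unique)
qed

locale quadratic_estimate = analytic_semigroup \<delta> S for \<delta> and S :: "complex \<Rightarrow> 'h::complex_hilbert \<Rightarrow> 'h" +
  fixes C :: real
  assumes C_nonneg: "0 \<le> C"
    and quad: "L2w_sq (\<lambda>s. s *\<^sub>R A_exp (adj (neg_generator S)) s h) \<le> ennreal ((C * norm h)\<^sup>2)"
begin

abbreviation G where "G \<equiv> neg_generator S"

lemma strongly_measurable_A_exp:
  assumes "f \<in> L2w"
  shows "strongly_measurable (lebesgue_on {0<..}) (\<lambda>s. A_exp G s (f s))"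
  by (rule strongly_measurable_compose2[OF strongly_measurable_ident L2wD(1)[OF assms]])
    (simp add: tendsto_A_exp)

text \<open>The scalar integral over the whole half line. It converges absolutely by the quadratic
  estimate and is the candidate for \<open>cinner (weak_int G f) h\<close>.\<close>

definition pairing :: "(real \<Rightarrow> 'h) \<Rightarrow> 'h \<Rightarrow> complex" where
  "pairing f h = (\<integral>s. cinner (A_exp G s (f s)) h \<partial>lebesgue_on {0<..})"

text \<open>The operator is moved to \<open>h\<close> and the integrand bounded by
  \<open>norm (f s) / sqrt s\<close> times \<open>sqrt s * norm (A_exp (adj G) s h)\<close>. Squared
  and integrated, these factors give \<open>L2w_sq f\<close> and the left side of the quadratic
  estimate.\<close>

lemma nn_integral_pairing_le:
  assumes f: "f \<in> L2w"
  shows "(\<integral>\<^sup>+s. ennreal (norm (cinner (A_exp G s (f s)) h)) \<partial>lebesgue_on {0<..})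
    \<le> ennreal (sqrt (enn2real (L2w_sq f)) * (C * norm h))"
proof -
  interpret L: complete_measure "lebesgue_on {0::real<..}" by (rule complete_measure_lebesgue_on) simp
  let ?g = "\<lambda>s. A_exp (adj G) s h"
  have [measurable]: "(\<lambda>t. norm (f t)) \<in> borel_measurable (lebesgue_on {0<..})"
    by (rule L.borel_measurable_norm_strongly_measurable[OF L2wD(1)[OF f]])
  have [measurable]: "(\<lambda>s. norm (?g s)) \<in> borel_measurable (lebesgue_on {0<..})"
    by (rule L.borel_measurable_norm_strongly_measurable, rule strongly_measurable_compose[OF strongly_measurable_ident])
      (simp add: tendsto_A_exp_adj)
  have [measurable]: "(\<lambda>s::real. s) \<in> borel_measurable (lebesgue_on {0<..})"
    by (rule L.borel_measurable_strongly_measurable[OF strongly_measurable_ident])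
  define X where "X = (\<integral>\<^sup>+s. ennreal (norm (f s) / sqrt s) * ennreal (sqrt s * norm (?g s)) \<partial>lebesgue_on {0<..})"
  have "X\<^sup>2 \<le> (\<integral>\<^sup>+s. ennreal (norm (f s) / sqrt s)^2 \<partial>lebesgue_on {0<..}) * (\<integral>\<^sup>+s. ennreal (sqrt s * norm (?g s))^2 \<partial>lebesgue_on {0<..})"
    unfolding X_def by (rule Cauchy_Schwarz_nn_integral) measurable
  also have "(\<integral>\<^sup>+s. ennreal (norm (f s) / sqrt s)^2 \<partial>lebesgue_on {0<..}) = L2w_sq f"
    unfolding L2w_sq_def by (rule nn_integral_cong) (simp add: ennreal_power power_divide)
  also have "(\<integral>\<^sup>+s. ennreal (sqrt s * norm (?g s))^2 \<partial>lebesgue_on {0<..}) = L2w_sq (\<lambda>s. s *\<^sub>R ?g s)"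
    unfolding L2w_sq_def by (rule nn_integral_cong) (simp add: ennreal_power power_mult_distrib, simp add: power2_eq_square)
  also have "L2w_sq f * L2w_sq (\<lambda>s. s *\<^sub>R ?g s) \<le> L2w_sq f * ennreal ((C * norm h)\<^sup>2)"
    by (intro mult_left_mono quad) simp
  also have "L2w_sq f = ennreal ((sqrt (enn2real (L2w_sq f)))\<^sup>2)"
    using L2wD(2)[OF f] by simp
  also have "\<dots> * ennreal ((C * norm h)\<^sup>2) = ennreal ((sqrt (enn2real (L2w_sq f)) * (C * norm h))\<^sup>2)"
    by (simp add: power_mult_distrib ennreal_mult)
  finally have X: "X \<le> ennreal (sqrt (enn2real (L2w_sq f)) * (C * norm h))"
    by (rule ennreal_le_of_square_le) (simp add: C_nonneg)
  have "(\<integral>\<^sup>+s. ennreal (norm (cinner (A_exp G s (f s)) h)) \<partial>lebesgue_on {0<..}) \<le> X"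
    unfolding X_def
  proof (rule nn_integral_mono)
    fix s :: real assume "s \<in> space (lebesgue_on {0<..})"
    then have s: "0 < s" by simp
    have "norm (cinner (A_exp G s (f s)) h) \<le> norm (f s) * norm (?g s)"
      unfolding cinner_A_exp[OF s] by (rule cinner_Cauchy_Schwarz)
    also have "\<dots> = norm (f s) / sqrt s * (sqrt s * norm (?g s))" using s by simp
    finally have "ennreal (norm (cinner (A_exp G s (f s)) h)) \<le> ennreal (norm (f s) / sqrt s * (sqrt s * norm (?g s)))"
      by (rule ennreal_leI)
    also have "\<dots> = ennreal (norm (f s) / sqrt s) * ennreal (sqrt s * norm (?g s))"
      using s by (intro ennreal_mult) auto
    finally show "ennreal (norm (cinner (A_exp G s (f s)) h)) \<le> \<dots>" .
  qed
  with X show ?thesis by (rule order_trans[rotated])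
qed

lemma integrable_pairing:
  assumes f: "f \<in> L2w"
  shows "integrable (lebesgue_on {0<..}) (\<lambda>s. cinner (A_exp G s (f s)) h)"
proof (rule integrableI_bounded)
  interpret L: complete_measure "lebesgue_on {0::real<..}" by (rule complete_measure_lebesgue_on) simp
  show "(\<lambda>s. cinner (A_exp G s (f s)) h) \<in> borel_measurable (lebesgue_on {0<..})"
    by (rule L.borel_measurable_strongly_measurable, rule strongly_measurable_compose[OF strongly_measurable_A_exp[OF f]])
      (rule tendsto_cinner[OF _ tendsto_const])
qed (rule order.strict_trans1[OF nn_integral_pairing_le[OF f]], simp)

lemma norm_pairing_le:
  assumes f: "f \<in> L2w" shows "cmod (pairing f h) \<le> sqrt (enn2real (L2w_sq f)) * C * norm h"
proof -
  have "ennreal (cmod (pairing f h)) \<le> ennreal (sqrt (enn2real (L2w_sq f)) * (C * norm h))"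
    unfolding pairing_def
    by (rule order_trans[OF integral_norm_bound_ennreal[OF integrable_pairing[OF f]] nn_integral_pairing_le[OF f]])
  then show ?thesis by (subst (asm) ennreal_le_iff) (auto simp: C_nonneg mult.assoc)
qed

text \<open>The operators \<open>A_exp G s\<close> with \<open>s \<ge> \<epsilon>\<close> are
  uniformly bounded by \<open>norm_D_le\<close>, so the truncated integral converges absolutely in
  norm and the pairing may be taken inside.\<close>

lemma cinner_strong_integral_A_exp:
  assumes f: "f \<in> L2w" and \<epsilon>: "0 < \<epsilon>"
  shows "cinner (strong_integral {\<epsilon>..R} (\<lambda>s. A_exp G s (f s))) h
    = (\<integral>s. indicator {\<epsilon>..R} s *\<^sub>R cinner (A_exp G s (f s)) h \<partial>lebesgue_on {0<..})"
proof -
  have sub: "{\<epsilon>..R} \<subseteq> {0<..}" using \<epsilon> by auto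
  have sm: "strongly_measurable (lebesgue_on {\<epsilon>..R}) (\<lambda>s. A_exp G s (f s))"
    by (rule strongly_measurable_restrict[OF strongly_measurable_A_exp[OF f]]) (use sub in auto)
  interpret L: complete_measure "lebesgue_on {\<epsilon>..R}" by (rule complete_measure_lebesgue_on) simp
  have [measurable]: "(\<lambda>s. norm (f s)) \<in> borel_measurable (lebesgue_on {\<epsilon>..R})"
    by (rule L.borel_measurable_norm_strongly_measurable[OF strongly_measurable_restrict[OF L2wD(1)[OF f]]]) (use sub in auto)
  define k where "k = onorm (D (complex_of_real \<epsilon>)) * B"
  have k: "0 \<le> k"
    using onorm_pos_le[OF bounded_clinearD(1)[OF D(1)[OF real_mem_sector[OF \<epsilon>]]]] B(1) by (simp add: k_def)
  have "(\<integral>\<^sup>+s. ennreal (norm (A_exp G s (f s))) \<partial>lebesgue_on {\<epsilon>..R}) \<le> (\<integral>\<^sup>+s. ennreal k * ennreal (norm (f s)) \<partial>lebesgue_on {\<epsilon>..R})"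
  proof (rule nn_integral_mono)
    fix s assume "s \<in> space (lebesgue_on {\<epsilon>..R})"
    then have "norm (A_exp G s (f s)) \<le> k * norm (f s)"
      using norm_D_le[OF \<epsilon>, of s "f s"] \<epsilon> by (simp add: A_exp_eq k_def)
    then show "ennreal (norm (A_exp G s (f s))) \<le> ennreal k * ennreal (norm (f s))"
      using k by (simp add: ennreal_leI flip: ennreal_mult)
  qed
  also have "\<dots> = ennreal k * (\<integral>\<^sup>+s. ennreal (norm (f s)) \<partial>lebesgue_on {\<epsilon>..R})" by (rule nn_integral_cmult) measurable
  also have "\<dots> < \<infinity>" using nn_integral_norm_Icc_finite[OF f \<epsilon>, of R] by (simp add: ennreal_mult_less_top)
  finally have "has_bochner_integral (lebesgue_on {\<epsilon>..R}) (\<lambda>s. cinner (A_exp G s (f s)) h)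
      (cinner (strong_integral {\<epsilon>..R} (\<lambda>s. A_exp G s (f s))) h)"
    by (intro strong_integral_cinner sm) auto
  then have "cinner (strong_integral {\<epsilon>..R} (\<lambda>s. A_exp G s (f s))) h = (\<integral>s. cinner (A_exp G s (f s)) h \<partial>lebesgue_on {\<epsilon>..R})"
    by (simp add: has_bochner_integral_integral_eq)
  also have "lebesgue_on {\<epsilon>..R} = restrict_space (lebesgue_on {0<..}) {\<epsilon>..R}"
    using sub by (subst restrict_restrict_space) (auto simp: Int_absorb1)
  also have "(\<integral>s. cinner (A_exp G s (f s)) h \<partial>restrict_space (lebesgue_on {0<..}) {\<epsilon>..R})
    = (\<integral>s. indicator {\<epsilon>..R} s *\<^sub>R cinner (A_exp G s (f s)) h \<partial>lebesgue_on {0<..})"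
    using sub by (intro integral_restrict_space) (auto simp: sets_restrict_space_iff Int_absorb1)
  finally show ?thesis .
qed

text \<open>The difference is an integral over the complement of \<open>{\<epsilon>..R}\<close>,
  dominated by the tail of an absolutely convergent scalar integral.\<close>

lemma tendsto_pairing:
  assumes f: "f \<in> L2w"
  shows "((\<lambda>(\<epsilon>, R). cinner (strong_integral {\<epsilon>..R} (\<lambda>s. A_exp G s (f s))) h) \<longlongrightarrow> pairing f h) (at_right 0 \<times>\<^sub>F at_top)"
proof -
  let ?g = "\<lambda>s. cinner (A_exp G s (f s)) h"
  let ?M = "lebesgue_on {0::real<..}"
  let ?E = "\<lambda>p. \<integral>\<^sup>+s. ennreal (norm (?g s)) * indicator (- {fst p..snd p}) s \<partial>?M"
  have g: "integrable ?M ?g" by (rule integrable_pairing[OF f])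
  have "(\<integral>\<^sup>+s. ennreal (norm (?g s)) \<partial>?M) < \<infinity>" using g by (simp add: integrable_iff_bounded)
  then have lim: "(?E \<longlongrightarrow> 0) (at_right 0 \<times>\<^sub>F at_top)"
    using tendsto_prod_at_right_at_top_null[of "\<lambda>s. ennreal (norm (?g s))"] g
    by (simp add: case_prod_beta')
  have ev: "\<forall>\<^sub>F p in at_right (0::real) \<times>\<^sub>F (at_top :: real filter). 0 < fst p"
    using eventually_prodI[of "\<lambda>x::real. 0 < x" "at_right 0" "\<lambda>_::real. True" at_top]
    by (simp add: eventually_at_right_less)
  have dist_le: "ennreal (norm (cinner (strong_integral {fst p..snd p} (\<lambda>s. A_exp G s (f s))) h - pairing f h)) \<le> ?E p"
    if p: "0 < fst p" for p
  proof -
    have int: "integrable ?M (\<lambda>s. indicator {fst p..snd p} s *\<^sub>R ?g s)"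
      using g p by (intro integrable_mult_indicator) (auto simp: sets_restrict_space_iff)
    have eq: "cinner (strong_integral {fst p..snd p} (\<lambda>s. A_exp G s (f s))) h - pairing f h
      = (\<integral>s. indicator {fst p..snd p} s *\<^sub>R ?g s - ?g s \<partial>?M)"
      unfolding cinner_strong_integral_A_exp[OF f p] pairing_def
      by (rule Bochner_Integration.integral_diff[symmetric, OF int g])
    have "ennreal (norm (\<integral>s. indicator {fst p..snd p} s *\<^sub>R ?g s - ?g s \<partial>?M))
      \<le> (\<integral>\<^sup>+s. ennreal (norm (indicator {fst p..snd p} s *\<^sub>R ?g s - ?g s)) \<partial>?M)"
      by (intro integral_norm_bound_ennreal Bochner_Integration.integrable_diff int g)
    also have "\<dots> = ?E p" by (rule nn_integral_cong) (auto simp: indicator_def)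
    finally show ?thesis unfolding eq .
  qed
  have "((\<lambda>p. ennreal (norm (cinner (strong_integral {fst p..snd p} (\<lambda>s. A_exp G s (f s))) h - pairing f h))) \<longlongrightarrow> ennreal 0) (at_right 0 \<times>\<^sub>F at_top)"
    by (rule tendsto_sandwich[OF _ _ tendsto_const[of "ennreal 0"] lim[folded ennreal_0]])
      (use ev dist_le in \<open>auto elim: eventually_mono\<close>)
  then have "((\<lambda>p. norm (cinner (strong_integral {fst p..snd p} (\<lambda>s. A_exp G s (f s))) h - pairing f h)) \<longlongrightarrow> 0) (at_right 0 \<times>\<^sub>F at_top)"
    by (subst (asm) tendsto_ennreal_iff) auto
  then show ?thesis by (simp add: case_prod_beta' tendsto_norm_zero_iff LIM_zero_iff)
qed

text \<open>\<open>pairing f\<close> is conjugate linear in \<open>h\<close>, so the Riesz theorem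
  is applied to its conjugate.\<close>

lemma pairing_eq_cinner:
  assumes f: "f \<in> L2w" obtains b where "\<And>h. pairing f h = cinner b h"
proof -
  obtain b where b: "\<And>h. cnj (pairing f h) = cinner h b"
  proof (rule riesz_representation[of UNIV "\<lambda>h. cnj (pairing f h)" "sqrt (enn2real (L2w_sq f)) * C"])
    show "closed_csubspace UNIV" by (simp add: closed_csubspace_def)
    show "cnj (pairing f (x + y)) = cnj (pairing f x) + cnj (pairing f y)" for x y
      by (simp add: pairing_def cinner_add_right Bochner_Integration.integral_add integrable_pairing[OF f])
    show "cnj (pairing f (c *\<^sub>C x)) = c * cnj (pairing f x)" for c x
      by (simp add: pairing_def cinner_scaleC_right)
    show "cmod (cnj (pairing f x)) \<le> sqrt (enn2real (L2w_sq f)) * C * norm x" for x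
      using norm_pairing_le[OF f] by simp
  qed auto
  have "pairing f h = cinner b h" for h
    using b[of h] by (metis cinner_commute complex_cnj_cnj)
  then show thesis by (rule that)
qed

text \<open>The filter is proper, so limits along it are unique. This replaces the limit in the
  definition by an identity, from which linearity and bounds of \<open>weak_int\<close> follow
  through \<open>pairing\<close>.\<close>

lemma is_weak_int_iff:
  assumes f: "f \<in> L2w" shows "is_weak_int G f x \<longleftrightarrow> (\<forall>h. pairing f h = cinner x h)"
proof -
  have "at_right (0::real) \<times>\<^sub>F (at_top :: real filter) \<noteq> bot" by (simp add: prod_filter_eq_bot)
  from tendsto_unique[OF this tendsto_pairing[OF f]] tendsto_pairing[OF f] show ?thesis
    unfolding is_weak_int_def by fastforce
qed

lemma cinner_weak_int:
  assumes f: "f \<in> L2w" shows "cinner (weak_int G f) h = pairing f h"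
proof -
  obtain b where b: "\<And>h. pairing f h = cinner b h" using pairing_eq_cinner[OF f] by blast
  have "weak_int G f = b"
    unfolding weak_int_def is_weak_int_iff[OF f]
    by (rule the_equality) (simp_all add: b cinner_eqI)
  then show ?thesis by (simp add: b)
qed

lemma is_weak_int_weak_int: "f \<in> L2w \<Longrightarrow> is_weak_int G f (weak_int G f)"
  by (simp add: is_weak_int_iff cinner_weak_int)

lemma norm_weak_int_le:
  assumes f: "f \<in> L2w" shows "ennreal ((norm (weak_int G f))\<^sup>2) \<le> ennreal (C\<^sup>2) * L2w_sq f"
proof -
  have "norm (weak_int G f) \<le> sqrt (enn2real (L2w_sq f)) * C"
    using norm_pairing_le[OF f] C_nonneg by (intro norm_le_cinnerI) (auto simp: cinner_weak_int[OF f])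
  then have "(norm (weak_int G f))\<^sup>2 \<le> (sqrt (enn2real (L2w_sq f)) * C)\<^sup>2" by (rule power_mono) simp
  then have "ennreal ((norm (weak_int G f))\<^sup>2) \<le> ennreal (C\<^sup>2 * enn2real (L2w_sq f))"
    by (intro ennreal_leI) (simp add: power_mult_distrib mult.commute)
  also have "\<dots> = ennreal (C\<^sup>2) * L2w_sq f"
    using L2wD(2)[OF f] by (simp add: ennreal_mult)
  finally show ?thesis .
qed

lemma A_exp_add: "0 < s \<Longrightarrow> A_exp G s (x + y) = A_exp G s x + A_exp G s y"
  using linear_add[OF bounded_linear.linear[OF bounded_clinearD(1)[OF D(1)[OF real_mem_sector]]]]
  by (simp add: A_exp_eq)

lemma A_exp_scaleC: "0 < s \<Longrightarrow> A_exp G s (c *\<^sub>C x) = c *\<^sub>C A_exp G s x"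
  using bounded_clinearD(2)[OF D(1)[OF real_mem_sector]] by (simp add: A_exp_eq scaleC_minus_right)

lemma weak_int_add:
  assumes f: "f \<in> L2w" and g: "g \<in> L2w"
  shows "weak_int G (\<lambda>s. f s + g s) = weak_int G f + weak_int G g"
proof (rule cinner_eqI)
  fix h
  have "pairing (\<lambda>s. f s + g s) h = (\<integral>s. cinner (A_exp G s (f s)) h + cinner (A_exp G s (g s)) h \<partial>lebesgue_on {0<..})"
    unfolding pairing_def by (rule Bochner_Integration.integral_cong) (simp_all add: A_exp_add cinner_add_left)
  also have "\<dots> = pairing f h + pairing g h"
    unfolding pairing_def by (intro Bochner_Integration.integral_add integrable_pairing f g)
  finally show "cinner (weak_int G (\<lambda>s. f s + g s)) h = cinner (weak_int G f + weak_int G g) h"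
    by (simp add: cinner_weak_int f g L2w_add cinner_add_left)
qed

lemma weak_int_scaleC:
  assumes f: "f \<in> L2w" shows "weak_int G (\<lambda>s. c *\<^sub>C f s) = c *\<^sub>C weak_int G f"
proof (rule cinner_eqI)
  fix h
  have "pairing (\<lambda>s. c *\<^sub>C f s) h = (\<integral>s. c * cinner (A_exp G s (f s)) h \<partial>lebesgue_on {0<..})"
    unfolding pairing_def by (rule Bochner_Integration.integral_cong) (simp_all add: A_exp_scaleC cinner_scaleC_left)
  then show "cinner (weak_int G (\<lambda>s. c *\<^sub>C f s)) h = cinner (c *\<^sub>C weak_int G f) h"
    by (simp add: cinner_weak_int f L2w_scaleC cinner_scaleC_left pairing_def)
qed

text \<open>The weak integral of \<open>F n - f\<close> is \<open>- weak_int G f\<close>, whose norm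
  is at most \<open>C\<close> times the distance of \<open>F n\<close> and \<open>f\<close>, for
  every \<open>n\<close>.\<close>

lemma weak_int_closed:
  assumes F: "\<And>n::nat. F n \<in> L2w" "\<And>n. weak_int G (F n) = 0" and f: "f \<in> L2w"
    and lim: "(\<lambda>n. L2w_sq (\<lambda>t. F n t - f t)) \<longlonglongrightarrow> 0"
  shows "weak_int G f = 0"
proof -
  have neg: "(\<lambda>t. (- 1) *\<^sub>C f t) \<in> L2w" by (rule L2w_scaleC[OF f])
  have m1: "(- 1) *\<^sub>C x = - x" for x :: 'h using scaleC_of_real[of "-1" x] by simp
  have d: "(\<lambda>t. F n t - f t) \<in> L2w" "weak_int G (\<lambda>t. F n t - f t) = - weak_int G f" for n
    using L2w_add[OF F(1) neg] weak_int_add[OF F(1) neg] weak_int_scaleC[OF f, of "-1"] F(2)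
    by (simp_all add: m1)
  have "ennreal ((norm (weak_int G f))\<^sup>2) \<le> ennreal (C\<^sup>2) * L2w_sq (\<lambda>t. F n t - f t)" for n
    using norm_weak_int_le[OF d(1)[of n]] by (simp add: d(2))
  moreover have "(\<lambda>n. ennreal (C\<^sup>2) * L2w_sq (\<lambda>t. F n t - f t)) \<longlonglongrightarrow> 0"
    using ennreal_tendsto_cmult[OF _ lim, of "ennreal (C\<^sup>2)"] by simp
  ultimately have "ennreal ((norm (weak_int G f))\<^sup>2) \<le> 0"
    by (intro LIMSEQ_le_const) auto
  then show ?thesis by (simp add: ennreal_eq_0_iff)
qed

end

theorem proposition1p6:
  fixes A :: "('h::complex_hilbert \<times> 'h) set"
    and Mtilde :: "(real \<Rightarrow> 'h) \<Rightarrow> (real \<Rightarrow> 'h)"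
    and C :: real
  assumes gen: "neg_generates_bdd_analytic A"
    and Mtilde: "is_M_tilde A Mtilde"
    and C: "0 \<le> C"
    and quad: "\<And>h. L2w_sq (\<lambda>s. s *\<^sub>R A_exp (adj A) s h) \<le> ennreal ((C * norm h)\<^sup>2)"
  shows
    "(\<forall>f\<in>L2w. \<exists>x. is_weak_int A f x) \<and>
     (\<forall>f\<in>L2w. M_minus A Mtilde f \<in> L2loc) \<and>
     (\<exists>C'::real. 0 \<le> C' \<and> (\<forall>f\<in>L2w.
        (SUP \<tau>\<in>{0<..}. ennreal (1 / \<tau>) *
           (\<integral>\<^sup>+t. ennreal ((norm (M_minus A Mtilde f t))\<^sup>2) \<partial>lebesgue_on {\<tau>..2 * \<tau>}))
        \<le> ennreal C' * L2w_sq f)) \<and>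
     (\<forall>f\<in>L2w. (dyadic_mean (M_minus A Mtilde f) \<longlongrightarrow> weak_int A f) (at_right 0)) \<and>
     (\<forall>f\<in>L2w. M_minus A Mtilde f \<in> L2w \<longleftrightarrow>
        (dyadic_mean (M_minus A Mtilde f) \<longlongrightarrow> 0) (at_right 0)) \<and>
     closed_subspace_L2w {f \<in> L2w. (dyadic_mean (M_minus A Mtilde f) \<longlongrightarrow> 0) (at_right 0)} \<and>
     (\<exists>C''::real. 0 \<le> C'' \<and>
        (\<forall>f\<in>L2w. (dyadic_mean (M_minus A Mtilde f) \<longlongrightarrow> 0) (at_right 0) \<longrightarrow>
           L2w_sq (M_minus A Mtilde f) \<le> ennreal (C''\<^sup>2) * L2w_sq f))"
proof -
  obtain \<delta> S where S: "0 < \<delta>" "\<delta> < pi / 2" "bdd_analytic_semigroup \<delta> S" and A: "neg_generator S = A"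
    using gen by (auto simp: neg_generates_bdd_analytic_def)
  interpret quadratic_estimate \<delta> S C
    by unfold_locales (use S C quad A in auto)
  \<comment> \<open>\<open>K\<close> may be negative and enters only through its square; this is why
    the last constant is taken as \<open>\<bar>K\<bar>\<close>.\<close>
  obtain K where MtL: "\<And>f. f \<in> L2w \<Longrightarrow> Mtilde f \<in> L2w"
    and MtK: "\<And>f. f \<in> L2w \<Longrightarrow> L2w_sq (Mtilde f) \<le> ennreal (K\<^sup>2) * L2w_sq f"
    using Mtilde unfolding is_M_tilde_def bounded_clinear_L2w_def by meson
  let ?b = "\<lambda>f. weak_int A f"
  have exp_eq: "exp_neg A t x = T t x" if "0 < t" for t x using exp_neg_eq[OF that] by (simp add: A)
  have v_sm: "strongly_measurable (lebesgue_on {0<..}) (\<lambda>t. exp_neg A t x)" for x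
  proof -
    have "strongly_measurable (lebesgue_on {0<..}) (\<lambda>t. T t x)"
    proof (rule strongly_measurable_compose[OF strongly_measurable_ident])
      fix s and u :: "nat \<Rightarrow> real" assume "s \<in> space (lebesgue_on {0<..})" and u: "u \<longlonglongrightarrow> s"
      then have s: "0 < s" by simp
      have "\<forall>\<^sub>F i in sequentially. 0 \<le> u i"
        using order_tendstoD(1)[OF u s] by eventually_elim simp
      then show "(\<lambda>i. T (u i) x) \<longlonglongrightarrow> T s x" using u s by (intro tendsto_T) auto
    qed
    then show ?thesis
      by (subst strongly_measurable_cong[of _ _ "\<lambda>t. T t x"]) (simp_all add: exp_eq)
  qed
  have v_le: "norm (exp_neg A t x) \<le> B * norm x" if "0 < t" for t x
    using norm_T_le[of t x] that by (simp add: exp_eq)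
  have v_lim: "((\<lambda>t. exp_neg A t x) \<longlongrightarrow> x) (at_right 0)" for x
  proof -
    have "((\<lambda>t. T t x) \<longlongrightarrow> T 0 x) (at_right 0)"
      by (rule tendsto_T) (auto simp: eventually_at_filter intro: tendsto_ident_at)
    moreover have "\<forall>\<^sub>F t in at_right 0. T t x = exp_neg A t x" by (simp add: eventually_at_filter exp_eq)
    ultimately show ?thesis using Lim_transform_eventually by (fastforce simp: S_0)
  qed
  have loc: "M_minus A Mtilde f \<in> L2loc" if "f \<in> L2w" for f
    by (rule perturbed_L2loc[where u = "Mtilde f" and v = "\<lambda>t. exp_neg A t (?b f)" and w = "M_minus A Mtilde f"
        and M = "B * norm (?b f)" and b = "?b f", OF MtL[OF that] v_sm v_le v_lim M_minus_def])
  have mean: "(dyadic_mean (M_minus A Mtilde f) \<longlongrightarrow> ?b f) (at_right 0)" if "f \<in> L2w" for f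
    by (rule perturbed_dyadic_mean[where u = "Mtilde f" and v = "\<lambda>t. exp_neg A t (?b f)" and w = "M_minus A Mtilde f"
        and M = "B * norm (?b f)" and b = "?b f", OF MtL[OF that] v_sm v_le v_lim M_minus_def])
  have mean_0_iff: "(dyadic_mean (M_minus A Mtilde f) \<longlongrightarrow> 0) (at_right 0) \<longleftrightarrow> ?b f = 0" if "f \<in> L2w" for f
    using mean[OF that] tendsto_unique[of "at_right (0::real)"] by auto
  \<comment> \<open>If the weak integral vanishes, the correction is the orbit of \<open>0\<close>,
    so membership and norm bound are inherited from \<open>Mtilde f\<close>.\<close>
  have M_eq: "M_minus A Mtilde f t = Mtilde f t" if "?b f = 0" "0 < t" for f t
    using that exp_eq[of t 0] linear_0[OF linear_T, of t] by (simp add: M_minus_def)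
  \<comment> \<open>\<open>4 * K\<^sup>2\<close> comes from \<open>4 * L2w_sq u\<close> and the
    bound of the extension; \<open>2 * B\<^sup>2 * C\<^sup>2\<close> comes from the bound
    \<open>B * norm (weak_int A f)\<close> of the orbit together with
    \<open>norm_weak_int_le\<close>.\<close>
  have sup: "(SUP \<tau>\<in>{0<..}. ennreal (1 / \<tau>) *
      (\<integral>\<^sup>+t. ennreal ((norm (M_minus A Mtilde f t))\<^sup>2) \<partial>lebesgue_on {\<tau>..2 * \<tau>}))
    \<le> ennreal (4 * K\<^sup>2 + 2 * B\<^sup>2 * C\<^sup>2) * L2w_sq f" if f: "f \<in> L2w" for f
  proof (rule SUP_least)
    fix \<tau> :: real assume "\<tau> \<in> {0<..}"
    then have "ennreal (1 / \<tau>) * (\<integral>\<^sup>+t. ennreal ((norm (M_minus A Mtilde f t))\<^sup>2) \<partial>lebesgue_on {\<tau>..2 * \<tau>})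
      \<le> 4 * L2w_sq (Mtilde f) + ennreal (2 * (B * norm (?b f))\<^sup>2)"
      by (intro perturbed_mean_square_le[where u = "Mtilde f" and v = "\<lambda>t. exp_neg A t (?b f)" and w = "M_minus A Mtilde f"
        and M = "B * norm (?b f)" and b = "?b f", OF MtL[OF f] v_sm v_le v_lim M_minus_def]) auto
    also have "ennreal (2 * (B * norm (?b f))\<^sup>2) = ennreal (2 * B\<^sup>2) * ennreal ((norm (?b f))\<^sup>2)"
      by (simp add: power_mult_distrib flip: ennreal_mult)
    also have "4 * L2w_sq (Mtilde f) + \<dots> \<le> 4 * (ennreal (K\<^sup>2) * L2w_sq f) + ennreal (2 * B\<^sup>2) * (ennreal (C\<^sup>2) * L2w_sq f)"
      using norm_weak_int_le[OF f] MtK[OF f] by (intro add_mono mult_left_mono) (auto simp: A)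
    also have "\<dots> = (4 * ennreal (K\<^sup>2) + ennreal (2 * B\<^sup>2) * ennreal (C\<^sup>2)) * L2w_sq f"
      by (simp add: distrib_right mult.assoc)
    also have "4 * ennreal (K\<^sup>2) + ennreal (2 * B\<^sup>2) * ennreal (C\<^sup>2) = ennreal (4 * K\<^sup>2 + 2 * B\<^sup>2 * C\<^sup>2)"
      by (simp add: ennreal_mult)
    finally show "ennreal (1 / \<tau>) * (\<integral>\<^sup>+t. ennreal ((norm (M_minus A Mtilde f t))\<^sup>2) \<partial>lebesgue_on {\<tau>..2 * \<tau>})
      \<le> ennreal (4 * K\<^sup>2 + 2 * B\<^sup>2 * C\<^sup>2) * L2w_sq f" .
  qed
  have mem_iff: "M_minus A Mtilde f \<in> L2w \<longleftrightarrow> (dyadic_mean (M_minus A Mtilde f) \<longlongrightarrow> 0) (at_right 0)"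
    if f: "f \<in> L2w" for f
  proof
    assume "(dyadic_mean (M_minus A Mtilde f) \<longlongrightarrow> 0) (at_right 0)"
    then have "?b f = 0" using mean_0_iff[OF f] by simp
    with L2w_cong(1)[of "M_minus A Mtilde f" "Mtilde f"] M_eq MtL[OF f] show "M_minus A Mtilde f \<in> L2w" by simp
  qed (rule L2w_dyadic_mean)
  have sq_le: "L2w_sq (M_minus A Mtilde f) \<le> ennreal (\<bar>K\<bar>\<^sup>2) * L2w_sq f"
    if "f \<in> L2w" "(dyadic_mean (M_minus A Mtilde f) \<longlongrightarrow> 0) (at_right 0)" for f
    using L2w_cong(2)[of "M_minus A Mtilde f" "Mtilde f"] M_eq mean_0_iff[OF that(1)] that(2) MtK[OF that(1)] by simp
  \<comment> \<open>The limit condition describes the kernel of the bounded linear map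
    \<open>weak_int A\<close>, hence a closed subspace.\<close>
  have "{f \<in> L2w. (dyadic_mean (M_minus A Mtilde f) \<longlongrightarrow> 0) (at_right 0)} = {f \<in> L2w. ?b f = 0}"
    using mean_0_iff by blast
  moreover have "closed_subspace_L2w {f \<in> L2w. ?b f = 0}"
    unfolding closed_subspace_L2w_def
  proof (intro conjI ballI allI impI)
    show "(\<lambda>t. 0) \<in> {f \<in> L2w. ?b f = 0}"
      using weak_int_scaleC[unfolded A, OF L2w_zero, of 0] L2w_zero by simp
    show "(\<lambda>t. f t + g t) \<in> {f \<in> L2w. ?b f = 0}" if "f \<in> {f \<in> L2w. ?b f = 0}" "g \<in> {f \<in> L2w. ?b f = 0}" for f g
      using that by (simp add: L2w_add weak_int_add[unfolded A])
    show "(\<lambda>t. c *\<^sub>C f t) \<in> {f \<in> L2w. ?b f = 0}" if "f \<in> {f \<in> L2w. ?b f = 0}" for c f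
      using that by (simp add: L2w_scaleC weak_int_scaleC[unfolded A])
    show "f \<in> {f \<in> L2w. ?b f = 0}"
      if "\<forall>n::nat. F n \<in> {f \<in> L2w. ?b f = 0}" "f \<in> L2w" "(\<lambda>n. L2w_sq (\<lambda>t. F n t - f t)) \<longlonglongrightarrow> 0" for F f
      using that weak_int_closed[unfolded A, of F f] by simp
  qed auto
  ultimately have "closed_subspace_L2w {f \<in> L2w. (dyadic_mean (M_minus A Mtilde f) \<longlongrightarrow> 0) (at_right 0)}" by simp
  moreover have "\<exists>x. is_weak_int A f x" if "f \<in> L2w" for f
    using is_weak_int_weak_int[OF that] by (auto simp: A)
  moreover have "\<exists>C'::real. 0 \<le> C' \<and> (\<forall>f\<in>L2w.
        (SUP \<tau>\<in>{0<..}. ennreal (1 / \<tau>) *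
           (\<integral>\<^sup>+t. ennreal ((norm (M_minus A Mtilde f t))\<^sup>2) \<partial>lebesgue_on {\<tau>..2 * \<tau>}))
        \<le> ennreal C' * L2w_sq f)"
    using sup by (intro exI[of _ "4 * K\<^sup>2 + 2 * B\<^sup>2 * C\<^sup>2"]) auto
  moreover have "\<exists>C''::real. 0 \<le> C'' \<and>
        (\<forall>f\<in>L2w. (dyadic_mean (M_minus A Mtilde f) \<longlongrightarrow> 0) (at_right 0) \<longrightarrow>
           L2w_sq (M_minus A Mtilde f) \<le> ennreal (C''\<^sup>2) * L2w_sq f)"
    using sq_le by (intro exI[of _ "\<bar>K\<bar>"]) auto
  ultimately show ?thesis using loc mean mem_iff by blast
qed

end
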